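(* Let $\Gamma$ be an arbitrary simplicial set (not necessarily a Kan complex), and let $A\to\Gamma$ be a Kan fibration. Let $\Delta^1\pitchfork_\Gamma A$ be the fibered path space of $A$ over $\Gamma$, and let $\mathrm{refl}\colon A\to\Delta^1\pitchfork_\Gamma A$ be the inclusion of constant paths. Let $\chi\colon Q\to P$ and $\rho\colon P\to\Delta^1\pitchfork_\Gamma A$ be a composable pair of Kan fibrations. Let $P_{\mathrm{refl}}:=A\times_{\Delta^1\pitchfork_\Gamma A}P$ be the pullback of $\rho$ along $\mathrm{refl}$, with projection $\mathrm{refl}_\rho\colon P_{\mathrm{refl}}\to P$. Let $d\colon P_{\mathrm{refl}}\to Q$ be a partial section of $\chi$ over $\mathrm{refl}_\rho$, i.e. a map with $\chi\circ d=\mathrm{refl}_\rho$. Then there exists a section of $\chi$ extending $d$: a map $s\colon P\to Q$ with $\chi\circ s=\mathrm{id}_P$ and $s\circ\mathrm{refl}_\rho=d$.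
   Context: We work in the category of simplicial sets with Quillen's model structure: cofibrations are the monomorphisms, fibrations are the Kan fibrations, and weak equivalences are the weak homotopy equivalences. For a Kan fibration $A\to\Gamma$ (a "space $A$ in context $\Gamma$"), the fibered path space is the pullback $\Delta^1\pitchfork_\Gamma A:=\Gamma\times_{\Gamma^{\Delta^1}}A^{\Delta^1}$, where $(-)^{\Delta^1}$ is the internal hom by the standard $1$-simplex, $\Gamma\to\Gamma^{\Delta^1}$ is the map induced by $\Delta^1\to\Delta^0$ (constant paths), and $A^{\Delta^1}\to\Gamma^{\Delta^1}$ is induced by $A\to\Gamma$. The map $\mathrm{refl}\colon A\to\Delta^1\pitchfork_\Gamma A$ is induced by the given map $A\to\Gamma$ together with the constant-path map $A\to A^{\Delta^1}$. *)

theory Defs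
  imports "HOL-Library.FuncSet"
begin

section \<open>Simplicial sets\<close>

text \<open>
  The ordinal $[n]$ is the set \<open>{..n}\<close> of natural numbers.  Morphisms are extensional functions
  (FuncSet), here and for simplicial maps below, so that equality of morphisms is HOL equality.
\<close>

definition op_maps :: "nat \<Rightarrow> nat \<Rightarrow> (nat \<Rightarrow> nat) set" where
  "op_maps m n = {\<theta> \<in> {..m} \<rightarrow>\<^sub>E {..n}. mono_on {..m} \<theta>}"

definition op_id :: "nat \<Rightarrow> nat \<Rightarrow> nat" where
  "op_id n = restrict (\<lambda>i. i) {..n}"

definition op_comp :: "nat \<Rightarrow> (nat \<Rightarrow> nat) \<Rightarrow> (nat \<Rightarrow> nat) \<Rightarrow> (nat \<Rightarrow> nat)" where
  "op_comp k \<theta> \<phi> = compose {..k} \<theta> \<phi>"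

text \<open>\<open>act X m n \<theta> x\<close> is the restriction along \<open>\<theta> : [m] \<rightarrow> [n]\<close> of the \<open>n\<close>-simplex \<open>x\<close>.\<close>

record 'a sset =
  simplices :: "nat \<Rightarrow> 'a set"
  act :: "nat \<Rightarrow> nat \<Rightarrow> (nat \<Rightarrow> nat) \<Rightarrow> 'a \<Rightarrow> 'a"

definition simplicial_set :: "'a sset \<Rightarrow> bool" where
  "simplicial_set X \<longleftrightarrow>
     (\<forall>m n \<theta> x. \<theta> \<in> op_maps m n \<longrightarrow> x \<in> simplices X n \<longrightarrow> act X m n \<theta> x \<in> simplices X m) \<and>
     (\<forall>n x. x \<in> simplices X n \<longrightarrow> act X n n (op_id n) x = x) \<and>
     (\<forall>k m n \<phi> \<theta> x. \<phi> \<in> op_maps k m \<longrightarrow> \<theta> \<in> op_maps m n \<longrightarrow> x \<in> simplices X n \<longrightarrow>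
        act X k n (op_comp k \<theta> \<phi>) x = act X k m \<phi> (act X m n \<theta> x))"

definition smaps :: "'a sset \<Rightarrow> 'b sset \<Rightarrow> (nat \<Rightarrow> 'a \<Rightarrow> 'b) set" where
  "smaps X Y = {f. (\<forall>n. f n \<in> simplices X n \<rightarrow>\<^sub>E simplices Y n) \<and>
     (\<forall>m n \<theta> x. \<theta> \<in> op_maps m n \<longrightarrow> x \<in> simplices X n \<longrightarrow>
        f m (act X m n \<theta> x) = act Y m n \<theta> (f n x))}"

definition smap_id :: "'a sset \<Rightarrow> nat \<Rightarrow> 'a \<Rightarrow> 'a" where
  "smap_id X = (\<lambda>n. restrict (\<lambda>x. x) (simplices X n))"

text \<open>\<open>smap_comp X g f\<close> is the composite \<open>g \<circ> f\<close>, where \<open>X\<close> is the domain of \<open>f\<close>.\<close>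

definition smap_comp ::
  "'a sset \<Rightarrow> (nat \<Rightarrow> 'b \<Rightarrow> 'c) \<Rightarrow> (nat \<Rightarrow> 'a \<Rightarrow> 'b) \<Rightarrow> (nat \<Rightarrow> 'a \<Rightarrow> 'c)" where
  "smap_comp X g f = (\<lambda>n. compose (simplices X n) (g n) (f n))"


section \<open>Standard simplices, horns and Kan fibrations\<close>

definition std_simplex :: "nat \<Rightarrow> (nat \<Rightarrow> nat) sset" where
  "std_simplex n = \<lparr>simplices = (\<lambda>m. op_maps m n), act = (\<lambda>k m \<phi> \<theta>. op_comp k \<theta> \<phi>)\<rparr>"

text \<open>The union of the faces of $\Delta^n$ opposite to the vertices \<open>i \<noteq> k\<close>.\<close>

definition horn :: "nat \<Rightarrow> nat \<Rightarrow> (nat \<Rightarrow> nat) sset" where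
  "horn n k = \<lparr>simplices = (\<lambda>m. {\<theta> \<in> op_maps m n. \<exists>i\<le>n. i \<noteq> k \<and> i \<notin> \<theta> ` {..m}}),
               act = (\<lambda>j m \<phi> \<theta>. op_comp j \<theta> \<phi>)\<rparr>"

definition horn_incl :: "nat \<Rightarrow> nat \<Rightarrow> nat \<Rightarrow> (nat \<Rightarrow> nat) \<Rightarrow> (nat \<Rightarrow> nat)" where
  "horn_incl n k = smap_id (horn n k)"

definition kan_fibration :: "'a sset \<Rightarrow> 'b sset \<Rightarrow> (nat \<Rightarrow> 'a \<Rightarrow> 'b) \<Rightarrow> bool" where
  "kan_fibration X Y p \<longleftrightarrow> p \<in> smaps X Y \<and>
     (\<forall>n\<ge>1. \<forall>k\<le>n. \<forall>u \<in> smaps (horn n k) X. \<forall>v \<in> smaps (std_simplex n) Y.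
        smap_comp (horn n k) p u = smap_comp (horn n k) v (horn_incl n k) \<longrightarrow>
        (\<exists>w \<in> smaps (std_simplex n) X.
           smap_comp (horn n k) w (horn_incl n k) = u \<and> smap_comp (std_simplex n) p w = v))"


section \<open>Products, pullbacks and internal homs\<close>

definition sprod :: "'a sset \<Rightarrow> 'b sset \<Rightarrow> ('a \<times> 'b) sset" where
  "sprod X Y = \<lparr>simplices = (\<lambda>n. simplices X n \<times> simplices Y n),
                act = (\<lambda>m n \<theta> (x, y). (act X m n \<theta> x, act Y m n \<theta> y))\<rparr>"

definition pullback ::
  "'a sset \<Rightarrow> 'b sset \<Rightarrow> (nat \<Rightarrow> 'a \<Rightarrow> 'c) \<Rightarrow> (nat \<Rightarrow> 'b \<Rightarrow> 'c) \<Rightarrow> ('a \<times> 'b) sset" where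
  "pullback X Y f g =
     \<lparr>simplices = (\<lambda>n. {(x, y). x \<in> simplices X n \<and> y \<in> simplices Y n \<and> f n x = g n y}),
      act = (\<lambda>m n \<theta> (x, y). (act X m n \<theta> x, act Y m n \<theta> y))\<rparr>"

definition pullback_snd ::
  "'a sset \<Rightarrow> 'b sset \<Rightarrow> (nat \<Rightarrow> 'a \<Rightarrow> 'c) \<Rightarrow> (nat \<Rightarrow> 'b \<Rightarrow> 'c) \<Rightarrow> nat \<Rightarrow> 'a \<times> 'b \<Rightarrow> 'b" where
  "pullback_snd X Y f g = (\<lambda>n. restrict snd (simplices (pullback X Y f g) n))"

text \<open>
  The internal hom $Y^K$: its \<open>n\<close>-simplices are the maps $\Delta^n \times K \to Y$, and an operator
  \<open>\<theta> : [m] \<rightarrow> [n]\<close> acts by precomposition with $\theta_* \times \mathrm{id}_K$.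
\<close>

definition op_times_id ::
  "nat \<Rightarrow> (nat \<Rightarrow> nat) \<Rightarrow> 'k sset \<Rightarrow> nat \<Rightarrow> (nat \<Rightarrow> nat) \<times> 'k \<Rightarrow> (nat \<Rightarrow> nat) \<times> 'k" where
  "op_times_id m \<theta> K =
     (\<lambda>j. restrict (\<lambda>(\<phi>, t). (op_comp j \<theta> \<phi>, t)) (simplices (sprod (std_simplex m) K) j))"

definition ihom :: "'k sset \<Rightarrow> 'y sset \<Rightarrow> (nat \<Rightarrow> (nat \<Rightarrow> nat) \<times> 'k \<Rightarrow> 'y) sset" where
  "ihom K Y = \<lparr>simplices = (\<lambda>n. smaps (sprod (std_simplex n) K) Y),
               act = (\<lambda>m n \<theta> \<alpha>. smap_comp (sprod (std_simplex m) K) \<alpha> (op_times_id m \<theta> K))\<rparr>"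

definition ihom_map :: "'k sset \<Rightarrow> 'x sset \<Rightarrow> (nat \<Rightarrow> 'x \<Rightarrow> 'y) \<Rightarrow>
    nat \<Rightarrow> (nat \<Rightarrow> (nat \<Rightarrow> nat) \<times> 'k \<Rightarrow> 'x) \<Rightarrow> (nat \<Rightarrow> (nat \<Rightarrow> nat) \<times> 'k \<Rightarrow> 'y)" where
  "ihom_map K X p =
     (\<lambda>n. restrict (\<lambda>\<alpha>. smap_comp (sprod (std_simplex n) K) p \<alpha>) (simplices (ihom K X) n))"

text \<open>
  The map $X \cong X^{\Delta^0} \to X^K$ induced by $K \to \Delta^0$: it sends \<open>x \<in> X\<^sub>n\<close> to the
  composite of the projection $\Delta^n \times K \to \Delta^n$ with the Yoneda map
  $\Delta^n \to X$ of \<open>x\<close>.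
\<close>

definition const_map :: "'k sset \<Rightarrow> 'x sset \<Rightarrow>
    nat \<Rightarrow> 'x \<Rightarrow> (nat \<Rightarrow> (nat \<Rightarrow> nat) \<times> 'k \<Rightarrow> 'x)" where
  "const_map K X = (\<lambda>n. restrict
     (\<lambda>x m. restrict (\<lambda>(\<theta>, t). act X m n \<theta> x) (simplices (sprod (std_simplex n) K) m))
     (simplices X n))"


section \<open>Fibered path space\<close>

type_synonym 'x path = "nat \<Rightarrow> (nat \<Rightarrow> nat) \<times> (nat \<Rightarrow> nat) \<Rightarrow> 'x"

definition interval :: "(nat \<Rightarrow> nat) sset" where
  "interval = std_simplex 1"

definition path_space ::
  "'g sset \<Rightarrow> 'a sset \<Rightarrow> (nat \<Rightarrow> 'a \<Rightarrow> 'g) \<Rightarrow> ('g \<times> 'a path) sset" where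
  "path_space \<Gamma> A p =
     pullback \<Gamma> (ihom interval A) (const_map interval \<Gamma>) (ihom_map interval A p)"

definition path_refl :: "'a sset \<Rightarrow> (nat \<Rightarrow> 'a \<Rightarrow> 'g) \<Rightarrow> nat \<Rightarrow> 'a \<Rightarrow> 'g \<times> 'a path" where
  "path_refl A p = (\<lambda>n. restrict (\<lambda>a. (p n a, const_map interval A n a)) (simplices A n))"


section \<open>Well-formedness of the constructions\<close>

lemma op_id_in [simp]: "op_id n \<in> op_maps n n"
  by (auto simp: op_maps_def op_id_def mono_on_def)

lemma op_comp_in:
  "\<lbrakk>\<phi> \<in> op_maps k m; \<theta> \<in> op_maps m n\<rbrakk> \<Longrightarrow> op_comp k \<theta> \<phi> \<in> op_maps k n"
  by (auto simp: op_maps_def op_comp_def compose_def mono_on_def PiE_iff)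

lemma op_comp_id_right: "\<theta> \<in> op_maps m n \<Longrightarrow> op_comp m \<theta> (op_id m) = \<theta>"
  by (auto simp: op_maps_def op_comp_def op_id_def compose_def PiE_iff extensional_def)

lemma op_comp_id_left: "\<theta> \<in> op_maps m n \<Longrightarrow> op_comp m (op_id n) \<theta> = \<theta>"
  by (auto simp: op_maps_def op_comp_def op_id_def compose_def PiE_iff extensional_def
      intro!: ext)

lemma op_comp_assoc:
  "\<phi> \<in> op_maps j k \<Longrightarrow> op_comp j (op_comp k \<theta> \<psi>) \<phi> = op_comp j \<theta> (op_comp j \<psi> \<phi>)"
  by (auto simp: op_maps_def op_comp_def compose_def PiE_iff extensional_def intro!: ext)

lemma simplicial_set_std_simplex: "simplicial_set (std_simplex n)"
  by (auto simp: simplicial_set_def std_simplex_def op_comp_in op_comp_id_right op_comp_assoc)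

lemma simplicial_set_interval: "simplicial_set interval"
  by (simp add: interval_def simplicial_set_std_simplex)

lemma horn_act:
  assumes "\<phi> \<in> op_maps j m" "\<theta> \<in> simplices (horn n k) m"
  shows "op_comp j \<theta> \<phi> \<in> simplices (horn n k) j"
proof -
  have "op_comp j \<theta> \<phi> ` {..j} \<subseteq> \<theta> ` {..m}"
    using assms(1) by (auto simp: op_maps_def op_comp_def compose_def PiE_iff)
  then show ?thesis
    using assms by (auto simp: horn_def op_comp_in)
qed

lemma simplicial_set_horn: "simplicial_set (horn n k)"
  unfolding simplicial_set_def
proof (intro conjI allI impI)
  fix j m \<phi> \<theta> assume "\<phi> \<in> op_maps j m" "\<theta> \<in> simplices (horn n k) m"
  then show "act (horn n k) j m \<phi> \<theta> \<in> simplices (horn n k) j"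
    using horn_act[of \<phi> j m \<theta> n k] unfolding horn_def by simp
qed (auto simp: horn_def op_comp_id_right op_comp_assoc)

lemma horn_incl_in: "horn_incl n k \<in> smaps (horn n k) (std_simplex n)"
  using simplicial_set_horn[of n k]
  unfolding simplicial_set_def smaps_def horn_incl_def smap_id_def
  by (auto simp: horn_def std_simplex_def)

lemma smap_id_in: "simplicial_set X \<Longrightarrow> smap_id X \<in> smaps X X"
  by (auto simp: simplicial_set_def smaps_def smap_id_def)

lemma smap_comp_in:
  assumes "simplicial_set X" "f \<in> smaps X Y" "g \<in> smaps Y Z"
  shows "smap_comp X g f \<in> smaps X Z"
  using assms unfolding smaps_def smap_comp_def simplicial_set_def
  by (auto simp: compose_def PiE_iff)

lemma smap_comp_assoc:
  "f \<in> smaps X Y \<Longrightarrow>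
   smap_comp X h (smap_comp X g f) = smap_comp X (smap_comp Y h g) f"
  by (auto simp: smaps_def smap_comp_def compose_def PiE_iff intro!: ext)

lemma simplicial_set_sprod:
  "\<lbrakk>simplicial_set X; simplicial_set Y\<rbrakk> \<Longrightarrow> simplicial_set (sprod X Y)"
  unfolding simplicial_set_def sprod_def by auto

lemma simplicial_set_pullback:
  assumes "simplicial_set X" "simplicial_set Y" "f \<in> smaps X Z" "g \<in> smaps Y Z"
  shows "simplicial_set (pullback X Y f g)"
  using assms unfolding simplicial_set_def pullback_def smaps_def by auto

lemma op_times_id_in:
  "\<lbrakk>\<theta> \<in> op_maps m n; simplicial_set K\<rbrakk> \<Longrightarrow>
   op_times_id m \<theta> K \<in> smaps (sprod (std_simplex m) K) (sprod (std_simplex n) K)"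
  unfolding smaps_def op_times_id_def simplicial_set_def
  by (auto simp: sprod_def std_simplex_def op_comp_in op_comp_assoc)

lemma op_times_id_id:
  "\<alpha> \<in> smaps (sprod (std_simplex n) K) Y \<Longrightarrow>
   smap_comp (sprod (std_simplex n) K) \<alpha> (op_times_id n (op_id n) K) = \<alpha>"
  unfolding smaps_def smap_comp_def op_times_id_def compose_def
  by (fastforce simp: sprod_def std_simplex_def op_comp_id_left PiE_iff extensional_def intro!: ext)

lemma op_times_id_comp:
  "\<phi> \<in> op_maps k m \<Longrightarrow>
   op_times_id k (op_comp k \<theta> \<phi>) K =
   smap_comp (sprod (std_simplex k) K) (op_times_id m \<theta> K) (op_times_id k \<phi> K)"
  unfolding smap_comp_def op_times_id_def compose_def
  by (auto simp: sprod_def std_simplex_def op_comp_in op_comp_assoc intro!: ext)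

lemma simplicial_set_ihom:
  assumes K: "simplicial_set K"
  shows "simplicial_set (ihom K Y)"
  unfolding simplicial_set_def
proof (intro conjI allI impI)
  fix m n \<theta> \<alpha> assume "\<theta> \<in> op_maps m n" "\<alpha> \<in> simplices (ihom K Y) n"
  then show "act (ihom K Y) m n \<theta> \<alpha> \<in> simplices (ihom K Y) m"
    unfolding ihom_def
    by (simp, intro smap_comp_in[OF simplicial_set_sprod])
      (auto simp: K simplicial_set_std_simplex op_times_id_in)
next
  fix n \<alpha> assume "\<alpha> \<in> simplices (ihom K Y) n"
  then show "act (ihom K Y) n n (op_id n) \<alpha> = \<alpha>"
    by (simp add: ihom_def op_times_id_id)
next
  fix k m n \<phi> \<theta> \<alpha>
  assume "\<phi> \<in> op_maps k m" "\<theta> \<in> op_maps m n" "\<alpha> \<in> simplices (ihom K Y) n"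
  then show "act (ihom K Y) k n (op_comp k \<theta> \<phi>) \<alpha>
      = act (ihom K Y) k m \<phi> (act (ihom K Y) m n \<theta> \<alpha>)"
    by (simp add: ihom_def op_times_id_comp smap_comp_assoc[OF op_times_id_in[OF _ K]])
qed

lemma ihom_map_in:
  assumes K: "simplicial_set K" and p: "p \<in> smaps X Y"
  shows "ihom_map K X p \<in> smaps (ihom K X) (ihom K Y)"
proof -
  have SK: "simplicial_set (sprod (std_simplex n) K)" for n
    by (simp add: K simplicial_set_sprod simplicial_set_std_simplex)
  have "act (ihom K X) m n \<theta> \<alpha> \<in> simplices (ihom K X) m"
    if "\<theta> \<in> op_maps m n" "\<alpha> \<in> simplices (ihom K X) n" for m n \<theta> \<alpha>
    using simplicial_set_ihom[OF K, of X] that by (auto simp: simplicial_set_def)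
  then show ?thesis
    unfolding smaps_def[of "ihom K X"] ihom_map_def
    by (auto simp: ihom_def smap_comp_in[OF SK _ p] smap_comp_assoc[OF op_times_id_in[OF _ K]])
qed

lemma const_map_in:
  assumes K: "simplicial_set K" and X: "simplicial_set X"
  shows "const_map K X \<in> smaps X (ihom K X)"
proof -
  have "const_map K X n x \<in> smaps (sprod (std_simplex n) K) X" if "x \<in> simplices X n" for n x
    using K X that unfolding smaps_def const_map_def simplicial_set_def
    by (auto simp: sprod_def std_simplex_def op_comp_in)
  moreover have "const_map K X m (act X m n \<theta> x)
      = smap_comp (sprod (std_simplex m) K) (const_map K X n x) (op_times_id m \<theta> K)"
    if "x \<in> simplices X n" "\<theta> \<in> op_maps m n" for m n \<theta> x
    using X that unfolding const_map_def smap_comp_def op_times_id_def compose_def simplicial_set_def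
    by (auto simp: sprod_def std_simplex_def op_comp_in intro!: ext)
  ultimately show ?thesis
    unfolding smaps_def[of X "ihom K X"]
    by (auto simp: ihom_def const_map_def)
qed

text \<open>
  \<open>const_map K X\<close> is the isomorphism \<open>const_map (std_simplex 0) X\<close> from $X$ to $X^{\Delta^0}$
  followed by precomposition with the unique map $K \to \Delta^0$.
\<close>

lemma const_map_factor:
  assumes "x \<in> simplices X n"
  shows "const_map K X n x =
    smap_comp (sprod (std_simplex n) K) (const_map (std_simplex 0) X n x)
      (\<lambda>m. restrict (\<lambda>(\<theta>, t). (\<theta>, restrict (\<lambda>_. 0) {..m}))
         (simplices (sprod (std_simplex n) K) m))"
  using assms unfolding const_map_def smap_comp_def compose_def
  by (auto simp: sprod_def std_simplex_def op_maps_def mono_on_def intro!: ext)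

lemma bij_const_map_point:
  assumes X: "simplicial_set X"
  shows "bij_betw (const_map (std_simplex 0) X n) (simplices X n)
           (simplices (ihom (std_simplex 0) X) n)"
proof (rule bij_betwI)
  let ?pt = "restrict (\<lambda>_. 0) :: nat set \<Rightarrow> nat \<Rightarrow> nat"
  have pt: "op_maps m 0 = {?pt {..m}}" for m
    by (auto simp: op_maps_def mono_on_def PiE_iff extensional_def intro!: ext)
  show "const_map (std_simplex 0) X n \<in> simplices X n \<rightarrow> simplices (ihom (std_simplex 0) X) n"
    using const_map_in[OF simplicial_set_std_simplex X] by (auto simp: smaps_def)
  show "(\<lambda>\<alpha>. \<alpha> n (op_id n, ?pt {..n})) \<in> simplices (ihom (std_simplex 0) X) n \<rightarrow> simplices X n"
    by (force simp: ihom_def smaps_def sprod_def std_simplex_def pt PiE_iff)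
  show "const_map (std_simplex 0) X n x n (op_id n, ?pt {..n}) = x" if "x \<in> simplices X n" for x
    using that X by (simp add: const_map_def sprod_def std_simplex_def pt simplicial_set_def)
  show "const_map (std_simplex 0) X n (\<alpha> n (op_id n, ?pt {..n})) = \<alpha>"
    if "\<alpha> \<in> simplices (ihom (std_simplex 0) X) n" for \<alpha>
  proof -
    have \<alpha>: "\<alpha> \<in> smaps (sprod (std_simplex n) (std_simplex 0)) X"
      using that by (simp add: ihom_def)
    have in0: "(\<theta>, ?pt {..m}) \<in> simplices (sprod (std_simplex n) (std_simplex 0)) m"
      if "\<theta> \<in> op_maps m n" for m \<theta>
      using that by (simp add: sprod_def std_simplex_def pt)
    have x: "\<alpha> n (op_id n, ?pt {..n}) \<in> simplices X n"
      using \<alpha> in0[OF op_id_in] by (auto simp: smaps_def)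
    have "act X m n \<theta> (\<alpha> n (op_id n, ?pt {..n})) = \<alpha> m (\<theta>, ?pt {..m})"
      if \<theta>: "\<theta> \<in> op_maps m n" for m \<theta>
    proof -
      have "op_comp m (?pt {..n}) \<theta> = ?pt {..m}"
        using op_comp_in[OF \<theta>, where \<theta> = "?pt {..n}" and n = 0] pt by auto
      then have "act (sprod (std_simplex n) (std_simplex 0)) m n \<theta> (op_id n, ?pt {..n})
          = (\<theta>, ?pt {..m})"
        using \<theta> by (simp add: sprod_def std_simplex_def op_comp_id_left)
      then show ?thesis
        using \<alpha> \<theta> in0[OF op_id_in] unfolding smaps_def by fastforce
    qed
    moreover have "\<alpha> m \<in> extensional (simplices (sprod (std_simplex n) (std_simplex 0)) m)" for m
      using \<alpha> by (simp add: smaps_def PiE_iff)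
    ultimately show ?thesis
      using x unfolding const_map_def
      by (fastforce simp: sprod_def std_simplex_def pt extensional_def intro!: ext)
  qed
qed

lemma const_map_natural:
  assumes "simplicial_set X" "p \<in> smaps X Y" "x \<in> simplices X n"
  shows "const_map K Y n (p n x) = smap_comp (sprod (std_simplex n) K) p (const_map K X n x)"
  using assms unfolding smaps_def const_map_def smap_comp_def compose_def
  by (auto simp: sprod_def std_simplex_def PiE_iff intro!: ext)

lemma simplicial_set_path_space:
  assumes "simplicial_set \<Gamma>" "p \<in> smaps A \<Gamma>"
  shows "simplicial_set (path_space \<Gamma> A p)"
  unfolding path_space_def
  by (rule simplicial_set_pullback[OF _ _ const_map_in ihom_map_in])
    (simp_all add: assms simplicial_set_ihom simplicial_set_interval)

lemma path_refl_in:
  assumes \<Gamma>: "simplicial_set \<Gamma>" and A: "simplicial_set A" and p: "p \<in> smaps A \<Gamma>"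
  shows "path_refl A p \<in> smaps A (path_space \<Gamma> A p)"
proof -
  have c: "const_map interval A \<in> smaps A (ihom interval A)"
    by (intro const_map_in A simplicial_set_interval)
  have c1: "const_map interval A n a \<in> simplices (ihom interval A) n" if "a \<in> simplices A n" for n a
    using c that by (auto simp: smaps_def)
  have c2: "const_map interval A m (act A m n \<theta> a) = act (ihom interval A) m n \<theta> (const_map interval A n a)"
    if "a \<in> simplices A n" "\<theta> \<in> op_maps m n" for m n \<theta> a
    using c that by (auto simp: smaps_def)
  have p1: "p n a \<in> simplices \<Gamma> n" if "a \<in> simplices A n" for n a
    using p that by (auto simp: smaps_def)
  have p2: "p m (act A m n \<theta> a) = act \<Gamma> m n \<theta> (p n a)"
    if "a \<in> simplices A n" "\<theta> \<in> op_maps m n" for m n \<theta> a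
    using p that by (auto simp: smaps_def)
  have "act A m n \<theta> a \<in> simplices A m" if "a \<in> simplices A n" "\<theta> \<in> op_maps m n" for m n \<theta> a
    using A that by (auto simp: simplicial_set_def)
  then show ?thesis
    unfolding smaps_def[of A "path_space \<Gamma> A p"]
    unfolding path_refl_def path_space_def pullback_def
    by (auto simp: c1 c2 p1 p2 ihom_map_def const_map_natural[OF A p])
qed

lemma pullback_snd_in:
  assumes "simplicial_set X" "simplicial_set Y" "f \<in> smaps X Z" "g \<in> smaps Y Z"
  shows "pullback_snd X Y f g \<in> smaps (pullback X Y f g) Y"
  using simplicial_set_pullback[OF assms]
  unfolding simplicial_set_def smaps_def pullback_snd_def
  by (auto simp: pullback_def)

end

theory Submission
  imports Defs
begin

text \<open>
  The homotopy $h(\alpha, t)(s) = \alpha(\min(t, s))$ contracts the fibered path space onto the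
  constant paths, relative to them and over $\Gamma$; no filling in $A$ is needed.  Let $X \subseteq P$
  be the preimage of the constant paths.  The homotopy extension lifting property of $\rho$ lifts $h$
  to a homotopy $K : P \times \Delta^1 \to P$ that ends at the identity, starts in $X$ and is
  constant on $X$.  Then $d \circ K$ is defined on $P \times \{0\} \cup X \times \Delta^1$ and lifts
  $K$ there; the same property of $\chi$ extends it to $P \times \Delta^1$, and its end at time 1 is
  the section.  The homotopy extension lifting property itself follows by attaching the nondegenerate
  simplices outside $X$ dimension by dimension, each as a prism that is filled by a sequence of horns.
\<close>

section \<open>Simplicial operators\<close>

text \<open>In model-category language, \<open>refl\<close> is a trivial cofibration, right
  properness makes its pullback along \<open>\<rho>\<close> one as well, and such a map lifts
  against \<open>\<chi>\<close>. Here fibrations are known only through horn fillers, so lifting the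
  contraction through \<open>\<rho>\<close> takes the place of right properness: it exhibits
  \<open>X\<close> as a deformation retract of \<open>P\<close>. The first lifting problem is given
  at time 1 and the second at time 0, which is why the extension property is proved for both ends
  \<open>e\<close> of the interval. The combinatorial obstacle is to attach all horns of one step
  simultaneously: values on the new simplices are well defined only if each of them is a face of
  exactly one prism in exactly one way. This is an Eilenberg-Zilber uniqueness statement, obtained
  from sections of monotone surjections.\<close>

lemma op_mapsD:
  assumes "\<theta> \<in> op_maps m n"
  shows op_maps_le: "i \<le> m \<Longrightarrow> \<theta> i \<le> n"
    and op_maps_mono: "i \<le> j \<Longrightarrow> j \<le> m \<Longrightarrow> \<theta> i \<le> \<theta> j"
  using assms by (auto simp: op_maps_def PiE_iff mono_on_def)

lemma op_maps_eqI:
  assumes "\<theta> \<in> op_maps m n" "\<phi> \<in> op_maps m n'" "\<And>i. i \<le> m \<Longrightarrow> \<theta> i = \<phi> i"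
  shows "\<theta> = \<phi>"
  using assms by (intro extensionalityI[of _ "{..m}"]) (auto simp: op_maps_def PiE_iff)

lemma restrict_in_op_maps:
  assumes "\<And>i. i \<le> m \<Longrightarrow> f i \<le> n" "\<And>i j. i \<le> j \<Longrightarrow> j \<le> m \<Longrightarrow> f i \<le> f j"
  shows "restrict f {..m} \<in> op_maps m n"
  using assms by (auto simp: op_maps_def mono_on_def)

lemma op_comp_apply [simp]: "i \<le> m \<Longrightarrow> op_comp m \<theta> \<phi> i = \<theta> (\<phi> i)"
  by (simp add: op_comp_def compose_def)

lemma op_id_apply [simp]: "i \<le> m \<Longrightarrow> op_id m i = i"
  by (simp add: op_id_def)

text \<open>Any choice of preimages under a monotone surjection is automatically monotone.
  Prescribing the preimage of \<open>\<theta> i\<close> lets \<open>cell_unique\<close> compare two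
  operators one argument at a time.\<close>

lemma op_surj_section:
  assumes \<theta>: "\<theta> \<in> op_maps m n" and surj: "\<theta> ` {..m} = {..n}" and i: "i \<le> m"
  obtains \<sigma> where "\<sigma> \<in> op_maps n m" "op_comp n \<theta> \<sigma> = op_id n" "\<sigma> (\<theta> i) = i"
proof
  define s where "s v = (if v = \<theta> i then i else SOME l. l \<le> m \<and> \<theta> l = v)" for v
  have s: "s v \<le> m \<and> \<theta> (s v) = v" if "v \<le> n" for v
  proof -
    have "\<exists>l. l \<le> m \<and> \<theta> l = v" using surj that by (metis atMost_iff imageE)
    from someI_ex[OF this] show ?thesis using i by (auto simp: s_def)
  qed
  have mono: "s v \<le> s v'" if "v \<le> v'" "v' \<le> n" for v v'
  proof (rule ccontr)
    assume *: "\<not> s v \<le> s v'"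
    then have "\<theta> (s v') \<le> \<theta> (s v)" using that s[of v] op_maps_mono[OF \<theta>, of "s v'" "s v"] by simp
    then have "v = v'" using that s[of v] s[of v'] by simp
    then show False using * by simp
  qed
  show *: "restrict s {..n} \<in> op_maps n m"
    by (rule restrict_in_op_maps) (use s mono in auto)
  show "op_comp n \<theta> (restrict s {..n}) = op_id n"
    by (rule op_maps_eqI[OF op_comp_in[OF * \<theta>] op_id_in]) (simp add: s)
  show "restrict s {..n} (\<theta> i) = i"
    using op_maps_le[OF \<theta> i] by (simp add: s_def)
qed

text \<open>Surjectivity forces injectivity. Counting the image of \<open>{..i}\<close> inside
  \<open>{..\<theta> i}\<close> gives \<open>i \<le> \<theta> i\<close>, and counting that of
  \<open>{i..n}\<close> gives the reverse inequality.\<close>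

lemma op_surj_endo:
  assumes \<theta>: "\<theta> \<in> op_maps n n" and surj: "\<theta> ` {..n} = {..n}"
  shows "\<theta> = op_id n"
proof (rule op_maps_eqI[OF \<theta> op_id_in])
  fix i assume i: "i \<le> n"
  have inj: "inj_on \<theta> {..n}" using surj by (simp add: eq_card_imp_inj_on)
  have "card (\<theta> ` {..i}) \<le> card {..\<theta> i}"
    using i op_maps_mono[OF \<theta>] by (intro card_mono) auto
  moreover have "card (\<theta> ` {..i}) = card {..i}"
    by (rule card_image) (use i inj in \<open>auto intro: inj_on_subset\<close>)
  moreover have "card (\<theta> ` {i..n}) \<le> card {\<theta> i..n}"
    using op_mapsD[OF \<theta>] by (intro card_mono) auto
  moreover have "card (\<theta> ` {i..n}) = card {i..n}"
    by (rule card_image) (use inj in \<open>auto intro: inj_on_subset\<close>)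
  ultimately show "\<theta> i = op_id n i" using i op_maps_le[OF \<theta> i] by simp
qed

text \<open>\<open>\<delta>\<close> is the coface that skips the missed value \<open>v\<close>, and
  \<open>\<psi>\<close> closes the gap by lowering all values above \<open>v\<close>.\<close>

lemma op_nonsurj_factor:
  assumes \<theta>: "\<theta> \<in> op_maps m n" and v: "v \<le> n" "v \<notin> \<theta> ` {..m}"
  obtains n' \<delta> \<psi> where "n' < n" "\<delta> \<in> op_maps n' n" "\<psi> \<in> op_maps m n'" "\<theta> = op_comp m \<delta> \<psi>"
proof -
  have ne: "\<theta> i \<noteq> v" if "i \<le> m" for i using v that by auto
  have "n \<noteq> 0" using op_maps_le[OF \<theta>, of 0] ne[of 0] v by auto
  then obtain n' where n: "n = Suc n'" by (cases n) auto
  define \<delta> where "\<delta> = restrict (\<lambda>i. if i < v then i else Suc i) {..n'}"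
  define \<psi> where "\<psi> = restrict (\<lambda>i. if \<theta> i < v then \<theta> i else \<theta> i - 1) {..m}"
  have \<delta>: "\<delta> \<in> op_maps n' n" unfolding \<delta>_def by (rule restrict_in_op_maps) (auto simp: n)
  have \<psi>_le: "(if \<theta> i < v then \<theta> i else \<theta> i - 1) \<le> n'" if "i \<le> m" for i
    using op_maps_le[OF \<theta> that] ne[OF that] v(1) n by auto
  have \<psi>: "\<psi> \<in> op_maps m n'" unfolding \<psi>_def
  proof (rule restrict_in_op_maps)
    fix i j assume "i \<le> j" "j \<le> m"
    then show "(if \<theta> i < v then \<theta> i else \<theta> i - 1) \<le> (if \<theta> j < v then \<theta> j else \<theta> j - 1)"
      using op_maps_mono[OF \<theta>, of i j] ne[of i] by auto
  qed (rule \<psi>_le)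
  have "\<theta> = op_comp m \<delta> \<psi>"
  proof (rule op_maps_eqI[OF \<theta> op_comp_in[OF \<psi> \<delta>]])
    fix i assume i: "i \<le> m"
    show "\<theta> i = op_comp m \<delta> \<psi> i"
      using i \<psi>_le[OF i] ne[OF i] by (auto simp: \<delta>_def \<psi>_def)
  qed
  with \<delta> \<psi> n that show ?thesis by blast
qed


section \<open>Partial simplicial maps\<close>

lemma simplicial_setD:
  assumes "simplicial_set X" "x \<in> simplices X n"
  shows act_in: "\<theta> \<in> op_maps m n \<Longrightarrow> act X m n \<theta> x \<in> simplices X m"
    and act_id: "act X n n (op_id n) x = x"
    and act_comp: "\<phi> \<in> op_maps k m \<Longrightarrow> \<theta> \<in> op_maps m n \<Longrightarrow>
        act X k m \<phi> (act X m n \<theta> x) = act X k n (op_comp k \<theta> \<phi>) x"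
  using assms by (simp_all add: simplicial_set_def)

lemma smapsD:
  assumes "f \<in> smaps X Y" "x \<in> simplices X n"
  shows smaps_in: "f n x \<in> simplices Y n"
    and smaps_act: "\<theta> \<in> op_maps m n \<Longrightarrow> f m (act X m n \<theta> x) = act Y m n \<theta> (f n x)"
  using assms by (auto simp: smaps_def)

definition subcomplex :: "'a sset \<Rightarrow> (nat \<Rightarrow> 'a set) \<Rightarrow> bool" where
  "subcomplex X V \<longleftrightarrow> (\<forall>m. V m \<subseteq> simplices X m) \<and>
     (\<forall>k m \<theta>. \<forall>x\<in>V m. \<theta> \<in> op_maps k m \<longrightarrow> act X k m \<theta> x \<in> V k)"

lemma subcomplexD:
  assumes "subcomplex X V" "x \<in> V m"
  shows subcomplex_in: "x \<in> simplices X m"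
    and subcomplex_act: "\<theta> \<in> op_maps k m \<Longrightarrow> act X k m \<theta> x \<in> V k"
  using assms by (auto simp: subcomplex_def)

text \<open>Unlike the elements of \<^const>\<open>smaps\<close>, partial maps are unconstrained outside their domain.\<close>

definition smap_on ::
  "'a sset \<Rightarrow> (nat \<Rightarrow> 'a set) \<Rightarrow> 'b sset \<Rightarrow> (nat \<Rightarrow> 'a \<Rightarrow> 'b) \<Rightarrow> bool" where
  "smap_on X V Y f \<longleftrightarrow> (\<forall>m. \<forall>x\<in>V m. f m x \<in> simplices Y m \<and>
     (\<forall>k. \<forall>\<theta>\<in>op_maps k m. f k (act X k m \<theta> x) = act Y k m \<theta> (f m x)))"

lemma smap_onI:
  assumes "\<And>m x. x \<in> V m \<Longrightarrow> f m x \<in> simplices Y m"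
    and "\<And>k m \<theta> x. x \<in> V m \<Longrightarrow> \<theta> \<in> op_maps k m \<Longrightarrow> f k (act X k m \<theta> x) = act Y k m \<theta> (f m x)"
  shows "smap_on X V Y f"
  using assms by (auto simp: smap_on_def)

lemma smap_onD:
  assumes "smap_on X V Y f" "x \<in> V m"
  shows smap_on_in: "f m x \<in> simplices Y m"
    and smap_on_act: "\<theta> \<in> op_maps k m \<Longrightarrow> f k (act X k m \<theta> x) = act Y k m \<theta> (f m x)"
  using assms by (auto simp: smap_on_def)

lemma smap_on_subset: "smap_on X V Y f \<Longrightarrow> (\<And>m. U m \<subseteq> V m) \<Longrightarrow> smap_on X U Y f"
  unfolding smap_on_def by blast

lemma restrict_in_smaps:
  assumes "smap_on X (simplices X) Y f" "simplicial_set X"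
  shows "(\<lambda>n. restrict (f n) (simplices X n)) \<in> smaps X Y"
  using smap_onD[OF assms(1)] act_in[OF assms(2)] by (auto simp: smaps_def)

definition lifts_on :: "'a sset \<Rightarrow> (nat \<Rightarrow> 'a set) \<Rightarrow> 'e sset \<Rightarrow> (nat \<Rightarrow> 'e \<Rightarrow> 'b) \<Rightarrow>
    (nat \<Rightarrow> 'a \<Rightarrow> 'b) \<Rightarrow> (nat \<Rightarrow> 'a \<Rightarrow> 'e) \<Rightarrow> bool" where
  "lifts_on W V E p g f \<longleftrightarrow> smap_on W V E f \<and> (\<forall>m. \<forall>x\<in>V m. p m (f m x) = g m x)"

lemma lifts_on_subset: "lifts_on W V E p g f \<Longrightarrow> (\<And>m. U m \<subseteq> V m) \<Longrightarrow> lifts_on W U E p g f"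
  unfolding lifts_on_def using smap_on_subset by blast


section \<open>Extending lifts along horns\<close>

text \<open>The Yoneda form of the Kan condition: the bottom map is the simplex \<open>b\<close>,
  and the filler is the value of the lifted map at \<open>op_id n\<close>.\<close>

lemma horn_filler:
  assumes E: "simplicial_set E" and B: "simplicial_set B" and p: "kan_fibration E B p"
    and n: "1 \<le> n" "k \<le> n" and b: "b \<in> simplices B n"
    and u: "smap_on (std_simplex n) (simplices (horn n k)) E u"
    and pu: "\<And>m \<phi>. \<phi> \<in> simplices (horn n k) m \<Longrightarrow> p m (u m \<phi>) = act B m n \<phi> b"
  obtains x where "x \<in> simplices E n" "p n x = b"
    "\<And>m \<phi>. \<phi> \<in> simplices (horn n k) m \<Longrightarrow> act E m n \<phi> x = u m \<phi>"
proof -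
  let ?H = "horn n k" and ?S = "std_simplex n"
  have horn_op: "\<phi> \<in> op_maps m n" if "\<phi> \<in> simplices ?H m" for m \<phi>
    using that by (simp add: horn_def)
  have act_H: "act ?H = act ?S" and simp_S: "simplices ?S m = op_maps m n" for m
    by (simp_all add: horn_def std_simplex_def)
  have act_S: "act ?S j m \<phi> \<theta> = op_comp j \<theta> \<phi>" for j m \<phi> \<theta> by (simp add: std_simplex_def)
  define u' where "u' = (\<lambda>m. restrict (u m) (simplices ?H m))"
  define v where "v = (\<lambda>m. restrict (\<lambda>\<phi>. act B m n \<phi> b) (simplices ?S m))"
  have u': "u' \<in> smaps ?H E" unfolding u'_def
    by (rule restrict_in_smaps) (use u simplicial_set_horn in \<open>auto simp: smap_on_def act_H\<close>)
  have v: "v \<in> smaps ?S B" unfolding v_def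
    by (rule restrict_in_smaps[OF _ simplicial_set_std_simplex], rule smap_onI)
      (use simplicial_setD[OF B b] in \<open>auto simp: simp_S act_S\<close>)
  have "smap_comp ?H p u' = smap_comp ?H v (horn_incl n k)"
    using horn_op by (auto simp: smap_comp_def compose_def u'_def v_def horn_incl_def smap_id_def pu simp_S
        intro!: ext)
  then obtain w where w: "w \<in> smaps ?S E" "smap_comp ?H w (horn_incl n k) = u'"
      "smap_comp ?S p w = v"
    using p n u' v unfolding kan_fibration_def by blast
  have id: "op_id n \<in> simplices ?S n" by (simp add: simp_S)
  have p_in: "p \<in> smaps E B" using p by (simp add: kan_fibration_def)
  show thesis
  proof
    show "w n (op_id n) \<in> simplices E n" by (rule smaps_in[OF w(1) id])
    have "p n (w n (op_id n)) = smap_comp ?S p w n (op_id n)"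
      using id by (simp add: smap_comp_def compose_def)
    then show "p n (w n (op_id n)) = b" using w(3) id act_id[OF B b] by (simp add: v_def)
    fix m \<phi> assume \<phi>: "\<phi> \<in> simplices ?H m"
    have "act E m n \<phi> (w n (op_id n)) = w m \<phi>"
      using smaps_act[OF w(1) id horn_op[OF \<phi>]] op_comp_id_left[OF horn_op[OF \<phi>]]
      by (simp add: act_S)
    also have "\<dots> = smap_comp ?H w (horn_incl n k) m \<phi>"
      using \<phi> by (simp add: smap_comp_def compose_def horn_incl_def smap_id_def)
    finally show "act E m n \<phi> (w n (op_id n)) = u m \<phi>" using w(2) \<phi> by (simp add: u'_def)
  qed
qed

text \<open>Extension along a pushout of a family of horn inclusions. By \<open>meet\<close> each
  simplex \<open>w i\<close> meets \<open>V\<close> exactly in the horn, so a filler agrees with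
  \<open>f\<close> there; by \<open>inj\<close> a simplex outside \<open>V\<close> belongs to one
  \<open>w i\<close> through one operator, so the separately chosen fillers never conflict.\<close>

lemma attach_horns:
  fixes w :: "'i \<Rightarrow> 'w"
  assumes W: "simplicial_set W" and E: "simplicial_set E" and B: "simplicial_set B"
    and p: "kan_fibration E B p" and n: "1 \<le> n" "k \<le> n"
    and V: "subcomplex W V" and g: "smap_on W (simplices W) B g"
    and f: "lifts_on W V E p g f"
    and w: "\<And>i. i \<in> I \<Longrightarrow> w i \<in> simplices W n"
    and meet: "\<And>i m \<phi>. i \<in> I \<Longrightarrow> \<phi> \<in> op_maps m n \<Longrightarrow>
       act W m n \<phi> (w i) \<in> V m \<longleftrightarrow> \<phi> \<in> simplices (horn n k) m"
    and inj: "\<And>i j m \<phi> \<psi>. i \<in> I \<Longrightarrow> j \<in> I \<Longrightarrow> \<phi> \<in> op_maps m n \<Longrightarrow> \<psi> \<in> op_maps m n \<Longrightarrow>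
       act W m n \<phi> (w i) = act W m n \<psi> (w j) \<Longrightarrow> act W m n \<phi> (w i) \<notin> V m \<Longrightarrow> i = j \<and> \<phi> = \<psi>"
  obtains f' where "lifts_on W (\<lambda>m. V m \<union> {act W m n \<phi> (w i) | i \<phi>. i \<in> I \<and> \<phi> \<in> op_maps m n}) E p g f'"
    "\<And>m x. x \<in> V m \<Longrightarrow> f' m x = f m x"
proof -
  have p_in: "p \<in> smaps E B" using p by (simp add: kan_fibration_def)
  have fs: "smap_on W V E f" and pf: "\<And>m x. x \<in> V m \<Longrightarrow> p m (f m x) = g m x"
    using f by (auto simp: lifts_on_def)
  have "\<exists>x \<in> simplices E n. p n x = g n (w i) \<and>
      (\<forall>m. \<forall>\<phi>\<in>simplices (horn n k) m. act E m n \<phi> x = f m (act W m n \<phi> (w i)))" if i: "i \<in> I" for i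
  proof -
    have op: "\<phi> \<in> op_maps m n" if "\<phi> \<in> simplices (horn n k) m" for m \<phi>
      using that by (simp add: horn_def)
    have inV: "act W m n \<phi> (w i) \<in> V m" if "\<phi> \<in> simplices (horn n k) m" for m \<phi>
      using meet[OF i op[OF that]] that by simp
    have u: "smap_on (std_simplex n) (simplices (horn n k)) E (\<lambda>m \<phi>. f m (act W m n \<phi> (w i)))"
    proof (rule smap_onI)
      fix m \<phi> assume \<phi>: "\<phi> \<in> simplices (horn n k) m"
      show "f m (act W m n \<phi> (w i)) \<in> simplices E m" using smap_on_in[OF fs inV[OF \<phi>]] .
      fix l \<theta> assume \<theta>: "\<theta> \<in> op_maps l m"
      show "f l (act W l n (act (std_simplex n) l m \<theta> \<phi>) (w i)) = act E l m \<theta> (f m (act W m n \<phi> (w i)))"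
        using smap_on_act[OF fs inV[OF \<phi>] \<theta>] act_comp[OF W w[OF i] \<theta> op[OF \<phi>]]
        by (simp add: std_simplex_def)
    qed
    show ?thesis
      by (rule horn_filler[OF E B p n smap_on_in[OF g w[OF i]] u])
        (use inV pf smap_on_act[OF g w[OF i] op] in auto)
  qed
  then obtain c where c: "\<And>i. i \<in> I \<Longrightarrow> c i \<in> simplices E n" "\<And>i. i \<in> I \<Longrightarrow> p n (c i) = g n (w i)"
    "\<And>i m \<phi>. i \<in> I \<Longrightarrow> \<phi> \<in> simplices (horn n k) m \<Longrightarrow> act E m n \<phi> (c i) = f m (act W m n \<phi> (w i))"
    by metis
  \<comment> \<open>Outside \<open>V\<close> the chosen pair is the only one, by \<open>inj\<close>,
    so \<open>SOME\<close> can be evaluated in \<open>f'w\<close>.\<close>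
  define f' where "f' m x = (if x \<in> V m then f m x else
    (let (i, \<phi>) = SOME (i, \<phi>). i \<in> I \<and> \<phi> \<in> op_maps m n \<and> x = act W m n \<phi> (w i)
     in act E m n \<phi> (c i)))" for m x
  have f'V: "f' m x = f m x" if "x \<in> V m" for m x using that by (simp add: f'_def)
  have f'w: "f' m (act W m n \<phi> (w i)) = act E m n \<phi> (c i)" if i: "i \<in> I" and \<phi>: "\<phi> \<in> op_maps m n" for m i \<phi>
  proof (cases "act W m n \<phi> (w i) \<in> V m")
    case True
    then show ?thesis using meet[OF i \<phi>] c(3)[OF i] by (simp add: f'_def)
  next
    case False
    have "(SOME (j, \<psi>). j \<in> I \<and> \<psi> \<in> op_maps m n \<and> act W m n \<phi> (w i) = act W m n \<psi> (w j)) = (i, \<phi>)"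
      by (rule some_equality) (use i \<phi> inj[OF i _ \<phi> _ _ False] in auto)
    then show ?thesis using False by (simp add: f'_def)
  qed
  have "lifts_on W (\<lambda>m. V m \<union> {act W m n \<phi> (w i) | i \<phi>. i \<in> I \<and> \<phi> \<in> op_maps m n}) E p g f'"
    unfolding lifts_on_def
  proof (intro conjI allI ballI smap_onI)
    fix m x assume x: "x \<in> V m \<union> {act W m n \<phi> (w i) | i \<phi>. i \<in> I \<and> \<phi> \<in> op_maps m n}"
    show "f' m x \<in> simplices E m"
      using x smap_on_in[OF fs] act_in[OF E c(1)] by (auto simp: f'V f'w)
    show "p m (f' m x) = g m x"
      using x pf smaps_act[OF p_in c(1)] smap_on_act[OF g w] c(2) by (auto simp: f'V f'w)
    fix l \<theta> assume \<theta>: "\<theta> \<in> op_maps l m"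
    show "f' l (act W l m \<theta> x) = act E l m \<theta> (f' m x)"
    proof (cases "x \<in> V m")
      case True
      then show ?thesis using smap_on_act[OF fs True \<theta>] subcomplex_act[OF V True \<theta>] by (simp add: f'V)
    next
      case False
      then obtain i \<phi> where i: "i \<in> I" and \<phi>: "\<phi> \<in> op_maps m n" and x: "x = act W m n \<phi> (w i)"
        using x by auto
      show ?thesis unfolding x
        by (simp add: i \<phi> f'w act_comp[OF W w[OF i] \<theta> \<phi>] act_comp[OF E c(1)[OF i] \<theta> \<phi>] op_comp_in[OF \<theta> \<phi>])
    qed
  qed
  with f'V that show thesis by blast
qed


section \<open>The prism\<close>

text \<open>The uniqueness half of the Eilenberg-Zilber lemma, relative to \<open>Z\<close>. A
  section \<open>\<sigma>\<close> of \<open>\<theta>\<close> exhibits \<open>z\<close> as the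
  restriction of \<open>z'\<close> along \<open>\<theta>' \<sigma>\<close>; since \<open>z\<close>
  is outside \<open>Z\<close>, this endomorphism is surjective, hence the identity.\<close>

lemma cell_unique:
  assumes Y: "simplicial_set Y" and Z: "subcomplex Y Z"
    and skel: "\<And>x m \<theta>. x \<in> simplices Y n \<Longrightarrow> \<theta> \<in> op_maps m n \<Longrightarrow> \<theta> ` {..m} \<noteq> {..n} \<Longrightarrow>
      act Y m n \<theta> x \<in> Z m"
    and z: "z \<in> simplices Y n" "z \<notin> Z n" and z': "z' \<in> simplices Y n"
    and \<theta>: "\<theta> \<in> op_maps m n" and \<theta>': "\<theta>' \<in> op_maps m n"
    and eq: "act Y m n \<theta> z = act Y m n \<theta>' z'" and notin: "act Y m n \<theta> z \<notin> Z m"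
  shows "z = z' \<and> \<theta> = \<theta>'"
proof -
  have surj: "\<theta> ` {..m} = {..n}" using skel[OF z(1) \<theta>] notin by blast
  have *: "z = z' \<and> \<theta>' i = \<theta> i" if i: "i \<le> m" for i
  proof -
    obtain \<sigma> where \<sigma>: "\<sigma> \<in> op_maps n m" "op_comp n \<theta> \<sigma> = op_id n" "\<sigma> (\<theta> i) = i"
      using op_surj_section[OF \<theta> surj i] .
    have z_eq: "z = act Y n n (op_comp n \<theta>' \<sigma>) z'"
      using act_comp[OF Y z(1) \<sigma>(1) \<theta>] act_comp[OF Y z' \<sigma>(1) \<theta>'] act_id[OF Y z(1)] \<sigma>(2) eq by simp
    have "op_comp n \<theta>' \<sigma> ` {..n} = {..n}"
      using skel[OF z' op_comp_in[OF \<sigma>(1) \<theta>']] z(2) z_eq by metis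
    then have id: "op_comp n \<theta>' \<sigma> = op_id n" by (rule op_surj_endo[OF op_comp_in[OF \<sigma>(1) \<theta>']])
    have "\<theta>' i = op_comp n \<theta>' \<sigma> (\<theta> i)" using \<sigma>(3) op_maps_le[OF \<theta> i] by simp
    then show ?thesis using id op_maps_le[OF \<theta> i] z_eq act_id[OF Y z'] by simp
  qed
  have "\<theta> = \<theta>'" by (rule op_maps_eqI[OF \<theta> \<theta>']) (use * in simp)
  with * show ?thesis by blast
qed

text \<open>
  \<open>prism_fst n q\<close> and \<open>prism_snd n q\<close> are the components of the nondegenerate \<open>(n + 1)\<close>-simplex
  $(0,0), \ldots, (q,0), (q,1), \ldots, (n,1)$ of $\Delta^n \times \Delta^1$.
\<close>

definition prism_fst :: "nat \<Rightarrow> nat \<Rightarrow> nat \<Rightarrow> nat" where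
  "prism_fst n q = restrict (\<lambda>i. if i \<le> q then i else i - 1) {..Suc n}"

definition prism_snd :: "nat \<Rightarrow> nat \<Rightarrow> nat \<Rightarrow> nat" where
  "prism_snd n q = restrict (\<lambda>i. if i \<le> q then 0 else 1) {..Suc n}"

lemma prism_in_op_maps:
  assumes "q \<le> n"
  shows "prism_fst n q \<in> op_maps (Suc n) n" "prism_snd n q \<in> op_maps (Suc n) 1"
  unfolding prism_fst_def prism_snd_def using assms by (auto intro!: restrict_in_op_maps)

text \<open>The first coordinate identifies only the vertices \<open>q\<close> and
  \<open>Suc q\<close>, and the second coordinate separates these two.\<close>

lemma prism_inj:
  assumes \<phi>: "\<phi> \<in> op_maps m (Suc n)" and \<psi>: "\<psi> \<in> op_maps m (Suc n)"
    and eq: "op_comp m (prism_fst n q) \<phi> = op_comp m (prism_fst n q) \<psi>"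
      "op_comp m (prism_snd n q) \<phi> = op_comp m (prism_snd n q) \<psi>"
  shows "\<phi> = \<psi>"
proof (rule op_maps_eqI[OF \<phi> \<psi>])
  fix i assume i: "i \<le> m"
  have "prism_fst n q (\<phi> i) = prism_fst n q (\<psi> i)" "prism_snd n q (\<phi> i) = prism_snd n q (\<psi> i)"
    using fun_cong[OF eq(1), of i] fun_cong[OF eq(2), of i] i by simp_all
  then show "\<phi> i = \<psi> i"
    using op_maps_le[OF \<phi> i] op_maps_le[OF \<psi> i]
    by (cases "\<phi> i \<le> q"; cases "\<psi> i \<le> q") (simp_all add: prism_fst_def prism_snd_def)
qed

text \<open>
  For \<open>j = 0, \<dots>, n + 1\<close> these are the simplices of a filtration of $\Delta^n \times \Delta^1$ starting
  at $\Delta^n \times \{e\}$.  Modulo $\partial\Delta^n \times \Delta^1$, step \<open>j\<close> fills a single horn, in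
  the prism simplex with index \<open>q = n - j\<close> if \<open>e = 0\<close> and \<open>q = j\<close> if \<open>e = 1\<close>.
\<close>

definition prism_stage :: "nat \<Rightarrow> nat \<Rightarrow> nat \<Rightarrow> nat \<Rightarrow> (nat \<Rightarrow> nat) \<Rightarrow> (nat \<Rightarrow> nat) \<Rightarrow> bool" where
  "prism_stage e n j m \<theta> t \<longleftrightarrow> (\<forall>i\<le>m. t i \<noteq> e \<longrightarrow> (if e = 0 then n < \<theta> i + j else \<theta> i < j))"

text \<open>A simplex that is new at step \<open>j\<close> has a vertex over \<open>q\<close> at the
  level other than \<open>e\<close>. Monotonicity and the stage bound then put all level-0 vertices
  at or before \<open>q\<close> and all level-1 vertices at or after it, so the simplex lies in the
  prism simplex of index \<open>q\<close>.\<close>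

lemma prism_stage_factor:
  assumes e: "e \<le> 1" and j: "j \<le> n" and q: "q = (if e = 0 then n - j else j)"
    and \<theta>: "\<theta> \<in> op_maps m n" and t: "t \<in> op_maps m 1"
    and st: "prism_stage e n (Suc j) m \<theta> t" "\<not> prism_stage e n j m \<theta> t"
  obtains \<phi> where "\<phi> \<in> op_maps m (Suc n)" "\<theta> = op_comp m (prism_fst n q) \<phi>"
    "t = op_comp m (prism_snd n q) \<phi>"
proof
  have qn: "q \<le> n" using j q by auto
  have t01: "t i = 0 \<or> t i = 1" if "i \<le> m" for i using op_maps_le[OF t that] by auto
  obtain i0 where i0: "i0 \<le> m" "t i0 \<noteq> e" "\<theta> i0 = q"
    using st q j by (force simp: prism_stage_def split: if_splits)
  have lo: "\<theta> i \<le> q" if i: "i \<le> m" "t i = 0" for i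
  proof (cases "e = 0")
    case True
    then have "t i0 = 1" using t01[OF i0(1)] i0 by auto
    then have "i \<le> i0" using op_maps_mono[OF t, of i0 i] i by (cases "i \<le> i0") auto
    then show ?thesis using op_maps_mono[OF \<theta> _ i0(1)] i0 by auto
  next
    case False
    then show ?thesis using st(1) i q unfolding prism_stage_def by (metis less_Suc_eq_le)
  qed
  have hi: "q \<le> \<theta> i" if i: "i \<le> m" "t i = 1" for i
  proof (cases "e = 0")
    case True
    then show ?thesis using st(1) i q by (auto simp: prism_stage_def)
  next
    case False
    then have "t i0 = 0" using e t01[OF i0(1)] i0 by auto
    then have "i0 \<le> i" using op_maps_mono[OF t, of i i0] i i0 by (cases "i0 \<le> i") auto
    then show ?thesis using op_maps_mono[OF \<theta> _ i(1)] i0 by auto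
  qed
  \<comment> \<open>In the chain of vertices of a prism simplex, the position of a vertex is the sum
    of its two coordinates.\<close>
  let ?\<phi> = "restrict (\<lambda>i. \<theta> i + t i) {..m}"
  have le: "\<theta> i + t i \<le> Suc n" if "i \<le> m" for i
    using op_maps_le[OF \<theta> that] op_maps_le[OF t that] by simp
  show \<phi>: "?\<phi> \<in> op_maps m (Suc n)"
    by (rule restrict_in_op_maps) (use le op_maps_mono[OF \<theta>] op_maps_mono[OF t] in \<open>auto intro: add_mono\<close>)
  show "\<theta> = op_comp m (prism_fst n q) ?\<phi>"
  proof (rule op_maps_eqI[OF \<theta> op_comp_in[OF \<phi> prism_in_op_maps(1)[OF qn]]])
    fix i assume i: "i \<le> m"
    show "\<theta> i = op_comp m (prism_fst n q) ?\<phi> i"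
      using i le[OF i] t01[OF i] lo[OF i] hi[OF i] by (auto simp: prism_fst_def)
  qed
  show "t = op_comp m (prism_snd n q) ?\<phi>"
  proof (rule op_maps_eqI[OF t op_comp_in[OF \<phi> prism_in_op_maps(2)[OF qn]]])
    fix i assume i: "i \<le> m"
    show "t i = op_comp m (prism_snd n q) ?\<phi> i"
      using i le[OF i] t01[OF i] lo[OF i] hi[OF i] by (auto simp: prism_snd_def)
  qed
qed

text \<open>The vertices \<open>q\<close> and \<open>q + 1\<close> of the prism simplex both project
  to \<open>q\<close>. The face opposite one of them, \<open>?l\<close>, is already present, and the
  face opposite the other, \<open>q + e\<close>, is the missing one; all remaining faces project
  into the boundary of the base. At the last step \<open>j = n\<close> the horn is an outer
  one.\<close>

lemma prism_horn_iff:
  assumes e: "e \<le> 1" and j: "j \<le> n" and q: "q = (if e = 0 then n - j else j)"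
    and \<phi>: "\<phi> \<in> op_maps m (Suc n)"
  shows "\<phi> \<in> simplices (horn (Suc n) (q + e)) m \<longleftrightarrow>
    op_comp m (prism_fst n q) \<phi> ` {..m} \<noteq> {..n} \<or>
    prism_stage e n j m (op_comp m (prism_fst n q) \<phi>) (op_comp m (prism_snd n q) \<phi>)"
    (is "_ \<longleftrightarrow> ?\<theta> ` _ \<noteq> _ \<or> ?stage")
proof -
  let ?l = "q + (1 - e)"
  have qn: "q \<le> n" using j q by auto
  have le: "\<phi> i \<le> Suc n" if "i \<le> m" for i using op_maps_le[OF \<phi> that] .
  have \<theta>: "?\<theta> i = (if \<phi> i \<le> q then \<phi> i else \<phi> i - 1)" if "i \<le> m" for i
    using that le[OF that] by (simp add: prism_fst_def)
  have \<theta>in: "?\<theta> \<in> op_maps m n" by (rule op_comp_in[OF \<phi> prism_in_op_maps(1)[OF qn]])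
  have horn: "\<phi> \<in> simplices (horn (Suc n) (q + e)) m \<longleftrightarrow>
      (\<exists>i\<le>Suc n. i \<noteq> q + e \<and> i \<notin> \<phi> ` {..m})"
    using \<phi> by (simp add: horn_def)
  \<comment> \<open>Of all vertices of the prism simplex only \<open>?l\<close> violates the bound
    of stage \<open>j\<close>.\<close>
  have stage: "?stage \<longleftrightarrow> ?l \<notin> \<phi> ` {..m}"
  proof -
    have "(op_comp m (prism_snd n q) \<phi> i \<noteq> e \<longrightarrow>
        (if e = 0 then n < ?\<theta> i + j else ?\<theta> i < j)) \<longleftrightarrow> \<phi> i \<noteq> ?l"
      if i: "i \<le> m" for i
      using e j q i le[OF i] \<theta>[OF i]
      by (cases "e = 0") (auto simp: prism_snd_def)
    then have "?stage \<longleftrightarrow> (\<forall>i\<le>m. \<phi> i \<noteq> ?l)" unfolding prism_stage_def by blast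
    also have "\<dots> \<longleftrightarrow> ?l \<notin> \<phi> ` {..m}" by (metis atMost_iff imageE imageI)
    finally show ?thesis .
  qed
  \<comment> \<open>Once \<open>?l\<close> is hit it covers the value \<open>q\<close>, so hitting
    \<open>q + e\<close> makes no difference; every other value has a single preimage in the prism
    simplex.\<close>
  have surj: "?\<theta> ` {..m} = {..n} \<longleftrightarrow> (\<forall>i\<le>Suc n. i \<noteq> q + e \<longrightarrow> i \<in> \<phi> ` {..m})" if l: "?l \<in> \<phi> ` {..m}"
  proof
    assume s: "?\<theta> ` {..m} = {..n}"
    show "\<forall>i\<le>Suc n. i \<noteq> q + e \<longrightarrow> i \<in> \<phi> ` {..m}"
    proof (intro allI impI)
      fix i assume i: "i \<le> Suc n" "i \<noteq> q + e"
      show "i \<in> \<phi> ` {..m}"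
      proof (cases "i = ?l")
        case False
        then have i': "i \<noteq> q" "i \<noteq> Suc q" using i e by (cases "e = 0"; auto)+
        then have "(if i < q then i else i - 1) \<in> ?\<theta> ` {..m}" unfolding s using i qn by auto
        then obtain a where a: "a \<le> m" "?\<theta> a = (if i < q then i else i - 1)" by force
        then have "\<phi> a = i" using \<theta>[OF a(1)] i' by (auto split: if_splits)
        then show ?thesis using a by auto
      qed (use l in simp)
    qed
  next
    assume r: "\<forall>i\<le>Suc n. i \<noteq> q + e \<longrightarrow> i \<in> \<phi> ` {..m}"
    have "v \<in> ?\<theta> ` {..m}" if v: "v \<le> n" for v
    proof -
      define i where "i = (if v < q then v else if v = q then ?l else Suc v)"
      have "i \<in> \<phi> ` {..m}"
        using r l v e qn by (cases "v = q") (auto simp: i_def)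
      then obtain a where a: "a \<le> m" "\<phi> a = i" by auto
      then have "?\<theta> a = v" using \<theta>[OF a(1)] e by (auto simp: i_def split: if_splits)
      then show ?thesis using a by (intro image_eqI[of _ _ a]) auto
    qed
    then show "?\<theta> ` {..m} = {..n}" using op_maps_le[OF \<theta>in] by auto
  qed
  have "?l \<le> Suc n" "?l \<noteq> q + e" using qn e by (cases "e = 0"; simp)+
  then show ?thesis unfolding horn stage using surj by blast
qed


section \<open>The homotopy extension lifting property\<close>

lemma sprod_interval [simp]:
  "simplices (sprod Y interval) m = simplices Y m \<times> op_maps m 1"
  "act (sprod Y interval) k m \<theta> (y, t) = (act Y k m \<theta> y, op_comp k t \<theta>)"
  by (simp_all add: sprod_def interval_def std_simplex_def)

text \<open>The union of Y x {e} and Z x Delta^1, i.e. the domain of the pushout product of Z -> Y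
  with {e} -> Delta^1.\<close>

definition cylinder :: "'y sset \<Rightarrow> (nat \<Rightarrow> 'y set) \<Rightarrow> nat \<Rightarrow> nat \<Rightarrow> ('y \<times> (nat \<Rightarrow> nat)) set" where
  "cylinder Y Z e m =
     {(y, t). y \<in> simplices Y m \<and> t \<in> op_maps m 1 \<and> ((\<forall>i\<le>m. t i = e) \<or> y \<in> Z m)}"

definition cylinder_stage ::
  "'y sset \<Rightarrow> (nat \<Rightarrow> 'y set) \<Rightarrow> nat \<Rightarrow> nat \<Rightarrow> nat \<Rightarrow> nat \<Rightarrow> ('y \<times> (nat \<Rightarrow> nat)) set" where
  "cylinder_stage Y Z e n j m = cylinder Y Z e m \<union>
     {(act Y m n \<theta> z, t) | z \<theta> t. z \<in> simplices Y n \<and> \<theta> \<in> op_maps m n \<and> t \<in> op_maps m 1 \<and>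
        prism_stage e n j m \<theta> t}"

lemma subcomplex_cylinder:
  assumes Y: "simplicial_set Y" and Z: "subcomplex Y Z"
  shows "subcomplex (sprod Y interval) (cylinder Y Z e)"
  unfolding subcomplex_def
proof (intro conjI allI ballI impI)
  show "cylinder Y Z e m \<subseteq> simplices (sprod Y interval) m" for m by (auto simp: cylinder_def)
  fix k m \<phi> x assume x: "x \<in> cylinder Y Z e m" and \<phi>: "\<phi> \<in> op_maps k m"
  show "act (sprod Y interval) k m \<phi> x \<in> cylinder Y Z e k"
    using x op_maps_le[OF \<phi>] act_in[OF Y _ \<phi>] subcomplex_act[OF Z _ \<phi>] op_comp_in[OF \<phi>]
    by (auto simp: cylinder_def)
qed

lemma subcomplex_cylinder_stage:
  assumes Y: "simplicial_set Y" and Z: "subcomplex Y Z"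
  shows "subcomplex (sprod Y interval) (cylinder_stage Y Z e n j)"
  unfolding subcomplex_def
proof (intro conjI allI ballI impI)
  note cyl = subcomplex_cylinder[OF Y Z, of e]
  show "cylinder_stage Y Z e n j m \<subseteq> simplices (sprod Y interval) m" for m
    using act_in[OF Y] by (auto simp: cylinder_def cylinder_stage_def)
  fix k m \<phi> x assume x: "x \<in> cylinder_stage Y Z e n j m" and \<phi>: "\<phi> \<in> op_maps k m"
  show "act (sprod Y interval) k m \<phi> x \<in> cylinder_stage Y Z e n j k"
  proof (cases "x \<in> cylinder Y Z e m")
    case True
    then show ?thesis using subcomplex_act[OF cyl True \<phi>] by (simp add: cylinder_stage_def)
  next
    case False
    then obtain z \<theta> t where x: "x = (act Y m n \<theta> z, t)" and z: "z \<in> simplices Y n"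
      and \<theta>: "\<theta> \<in> op_maps m n" and t: "t \<in> op_maps m 1" and st: "prism_stage e n j m \<theta> t"
      using x by (auto simp: cylinder_stage_def)
    have "prism_stage e n j k (op_comp k \<theta> \<phi>) (op_comp k t \<phi>)"
      using st op_maps_le[OF \<phi>] by (simp add: prism_stage_def)
    then show ?thesis
      using x z op_comp_in[OF \<phi> \<theta>] op_comp_in[OF \<phi> t] act_comp[OF Y z \<phi> \<theta>]
      by (auto simp: cylinder_stage_def)
  qed
qed

text \<open>One horn is attached for each \<open>n\<close>-simplex outside \<open>Z\<close>, all by
  a single use of \<open>attach_horns\<close>. The hypothesis \<open>skel\<close> says that
  boundaries of \<open>n\<close>-simplices already lie in \<open>Z\<close>.\<close>

lemma lift_cylinder_stage_Suc:
  assumes Y: "simplicial_set Y" and E: "simplicial_set E" and B: "simplicial_set B"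
    and p: "kan_fibration E B p" and e: "e \<le> 1" and j: "j \<le> n" and Z: "subcomplex Y Z"
    and skel: "\<And>x m \<theta>. x \<in> simplices Y n \<Longrightarrow> \<theta> \<in> op_maps m n \<Longrightarrow> \<theta> ` {..m} \<noteq> {..n} \<Longrightarrow>
      act Y m n \<theta> x \<in> Z m"
    and g: "smap_on (sprod Y interval) (simplices (sprod Y interval)) B g"
    and f: "lifts_on (sprod Y interval) (cylinder_stage Y Z e n j) E p g f"
  obtains f' where "lifts_on (sprod Y interval) (cylinder_stage Y Z e n (Suc j)) E p g f'"
    "\<And>m x. x \<in> cylinder_stage Y Z e n j m \<Longrightarrow> f' m x = f m x"
proof -
  let ?W = "sprod Y interval" and ?V = "cylinder_stage Y Z e n j"
  define q where "q = (if e = 0 then n - j else j)"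
  have qn: "q \<le> n" using j by (simp add: q_def)
  let ?s = "prism_fst n q" and ?t = "prism_snd n q"
  note st_in = prism_in_op_maps[OF qn]
  \<comment> \<open>For the relative skeleton as \<open>Z\<close>, these are the nondegenerate
    \<open>n\<close>-simplices outside \<open>X\<close>.\<close>
  define I where "I = simplices Y n - Z n"
  define w where "w z = (act Y (Suc n) n ?s z, ?t)" for z
  have IY: "z \<in> simplices Y n" if "z \<in> I" for z using that by (simp add: I_def)
  have act_w: "act ?W m (Suc n) \<phi> (w z) = (act Y m n (op_comp m ?s \<phi>) z, op_comp m ?t \<phi>)"
    if "z \<in> simplices Y n" "\<phi> \<in> op_maps m (Suc n)" for z m \<phi>
    using that st_in by (simp add: w_def act_comp[OF Y])
  have unique: "z = z' \<and> \<theta> = \<theta>'"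
    if "z \<in> I" "z' \<in> simplices Y n" "\<theta> \<in> op_maps m n" "\<theta>' \<in> op_maps m n"
      "act Y m n \<theta> z = act Y m n \<theta>' z'" "act Y m n \<theta> z \<notin> Z m" for z z' m \<theta> \<theta>'
    using cell_unique[OF Y Z skel _ _ that(2-6)] that(1) by (auto simp: I_def)
  \<comment> \<open>Restricting further along a section of \<open>\<theta>\<close> would bring
    \<open>z\<close> itself into \<open>Z\<close>.\<close>
  have surj_notin: "act Y m n \<theta> z \<notin> Z m"
    if z: "z \<in> I" and \<theta>: "\<theta> \<in> op_maps m n" and surj: "\<theta> ` {..m} = {..n}" for z m \<theta>
  proof
    assume "act Y m n \<theta> z \<in> Z m"
    moreover obtain \<sigma> where \<sigma>: "\<sigma> \<in> op_maps n m" "op_comp n \<theta> \<sigma> = op_id n"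
      using op_surj_section[OF \<theta> surj, of 0] by auto
    ultimately have "act Y n m \<sigma> (act Y m n \<theta> z) \<in> Z n" using subcomplex_act[OF Z] by blast
    then show False using z \<sigma> act_comp[OF Y IY[OF z] \<sigma>(1) \<theta>] act_id[OF Y IY[OF z]] by (simp add: I_def)
  qed
  have const_stage: "prism_stage e n j m \<theta> t" if "\<forall>i\<le>m. t i = e" for m \<theta> t
    using that by (simp add: prism_stage_def)
  have notinD: "act ?W m (Suc n) \<phi> (w z) \<in> ?V m \<longleftrightarrow> \<phi> \<in> simplices (horn (Suc n) (q + e)) m"
      "act ?W m (Suc n) \<phi> (w z) \<notin> ?V m \<Longrightarrow> act Y m n (op_comp m ?s \<phi>) z \<notin> Z m"
    if z: "z \<in> I" and \<phi>: "\<phi> \<in> op_maps m (Suc n)" for z m \<phi>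
  proof -
    let ?\<theta> = "op_comp m ?s \<phi>" and ?u = "op_comp m ?t \<phi>"
    have \<theta>: "?\<theta> \<in> op_maps m n" and u: "?u \<in> op_maps m 1"
      using op_comp_in[OF \<phi>] st_in by auto
    have y: "act Y m n ?\<theta> z \<in> simplices Y m" by (rule act_in[OF Y IY[OF z] \<theta>])
    have hornI: "\<phi> \<in> simplices (horn (Suc n) (q + e)) m \<longleftrightarrow>
        ?\<theta> ` {..m} \<noteq> {..n} \<or> prism_stage e n j m ?\<theta> ?u"
      by (rule prism_horn_iff[OF e j q_def \<phi>])
    have inZ: "act Y m n ?\<theta> z \<in> Z m \<longleftrightarrow> ?\<theta> ` {..m} \<noteq> {..n}"
      using skel[OF IY[OF z] \<theta>] surj_notin[OF z \<theta>] by blast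
    have inV: "(act Y m n ?\<theta> z, ?u) \<in> ?V m \<longleftrightarrow>
        act Y m n ?\<theta> z \<in> Z m \<or> prism_stage e n j m ?\<theta> ?u"
    proof
      assume "(act Y m n ?\<theta> z, ?u) \<in> ?V m"
      then consider "\<forall>i\<le>m. ?u i = e" | "act Y m n ?\<theta> z \<in> Z m"
        | z' \<theta>' where "z' \<in> simplices Y n" "\<theta>' \<in> op_maps m n"
            "act Y m n ?\<theta> z = act Y m n \<theta>' z'" "prism_stage e n j m \<theta>' ?u"
        by (auto simp: cylinder_stage_def cylinder_def)
      \<comment> \<open>A presentation through some other \<open>z'\<close> could satisfy the stage
        bound by a different operator; outside \<open>Z\<close> uniqueness gives
        \<open>\<theta>' = ?\<theta>\<close>.\<close>
      then show "act Y m n ?\<theta> z \<in> Z m \<or> prism_stage e n j m ?\<theta> ?u"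
        using const_stage unique[OF z _ \<theta>] by cases metis+
    next
      assume "act Y m n ?\<theta> z \<in> Z m \<or> prism_stage e n j m ?\<theta> ?u"
      then show "(act Y m n ?\<theta> z, ?u) \<in> ?V m"
        using y u \<theta> IY[OF z] by (auto simp: cylinder_stage_def cylinder_def)
    qed
    show "act ?W m (Suc n) \<phi> (w z) \<in> ?V m \<longleftrightarrow> \<phi> \<in> simplices (horn (Suc n) (q + e)) m"
      unfolding act_w[OF IY[OF z] \<phi>] inV hornI inZ ..
    show "act Y m n ?\<theta> z \<notin> Z m" if "act ?W m (Suc n) \<phi> (w z) \<notin> ?V m"
      using that unfolding act_w[OF IY[OF z] \<phi>] inV by blast
  qed
  have W: "simplicial_set ?W" by (intro simplicial_set_sprod Y simplicial_set_interval)
  obtain f' where f': "lifts_on ?W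
      (\<lambda>m. ?V m \<union> {act ?W m (Suc n) \<phi> (w z) | z \<phi>. z \<in> I \<and> \<phi> \<in> op_maps m (Suc n)}) E p g f'"
    and f'f: "\<And>m x. x \<in> ?V m \<Longrightarrow> f' m x = f m x"
  proof (rule attach_horns[OF W E B p _ _ subcomplex_cylinder_stage[OF Y Z] g f])
    show "1 \<le> Suc n" "q + e \<le> Suc n" using qn e by auto
    show "w z \<in> simplices ?W (Suc n)" if "z \<in> I" for z
      using act_in[OF Y IY[OF that]] st_in by (auto simp: w_def)
    show "z = z' \<and> \<phi> = \<psi>"
      if z: "z \<in> I" "z' \<in> I" and \<phi>: "\<phi> \<in> op_maps m (Suc n)" and \<psi>: "\<psi> \<in> op_maps m (Suc n)"
        and eq: "act ?W m (Suc n) \<phi> (w z) = act ?W m (Suc n) \<psi> (w z')"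
        and V: "act ?W m (Suc n) \<phi> (w z) \<notin> ?V m" for z z' m \<phi> \<psi>
    proof -
      have eqs: "act Y m n (op_comp m ?s \<phi>) z = act Y m n (op_comp m ?s \<psi>) z'"
          "op_comp m ?t \<phi> = op_comp m ?t \<psi>"
        using eq by (simp_all add: act_w IY z \<phi> \<psi>)
      have "z = z' \<and> op_comp m ?s \<phi> = op_comp m ?s \<psi>"
        by (rule unique[OF z(1) IY[OF z(2)] op_comp_in[OF \<phi> st_in(1)] op_comp_in[OF \<psi> st_in(1)]
              eqs(1) notinD(2)[OF z(1) \<phi> V]])
      then show ?thesis using prism_inj[OF \<phi> \<psi> _ eqs(2)] by blast
    qed
  qed (use notinD(1) in auto)
  have "cylinder_stage Y Z e n (Suc j) m \<subseteq>
      ?V m \<union> {act ?W m (Suc n) \<phi> (w z) | z \<phi>. z \<in> I \<and> \<phi> \<in> op_maps m (Suc n)}" for m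
  proof
    fix x assume x: "x \<in> cylinder_stage Y Z e n (Suc j) m"
    show "x \<in> ?V m \<union> {act ?W m (Suc n) \<phi> (w z) | z \<phi>. z \<in> I \<and> \<phi> \<in> op_maps m (Suc n)}"
    proof (cases "x \<in> ?V m")
      case False
      then obtain z \<theta> t where x: "x = (act Y m n \<theta> z, t)" and z: "z \<in> simplices Y n"
        and \<theta>: "\<theta> \<in> op_maps m n" and t: "t \<in> op_maps m 1" and st: "prism_stage e n (Suc j) m \<theta> t"
        using x by (auto simp: cylinder_stage_def)
      have "\<not> prism_stage e n j m \<theta> t" using False x z \<theta> t by (auto simp: cylinder_stage_def)
      then obtain \<phi> where \<phi>: "\<phi> \<in> op_maps m (Suc n)" "\<theta> = op_comp m ?s \<phi>" "t = op_comp m ?t \<phi>"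
        using prism_stage_factor[OF e j q_def \<theta> t st] by blast
      have "act Y m n \<theta> z \<notin> Z m"
        using False x t act_in[OF Y z \<theta>] by (auto simp: cylinder_stage_def cylinder_def)
      then have "z \<in> I" using subcomplex_act[OF Z _ \<theta>] z by (auto simp: I_def)
      then show ?thesis using act_w[OF z \<phi>(1)] \<phi> x by auto
    qed simp
  qed
  from lifts_on_subset[OF f' this] f'f that show thesis by blast
qed

text \<open>Stage 0 adds nothing to the cylinder, and stage \<open>Suc n\<close> contains the full
  prisms over all \<open>n\<close>-simplices, so \<open>n + 1\<close> steps suffice.\<close>

lemma lift_cylinder_cells:
  assumes Y: "simplicial_set Y" and E: "simplicial_set E" and B: "simplicial_set B"
    and p: "kan_fibration E B p" and e: "e \<le> 1" and Z: "subcomplex Y Z"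
    and skel: "\<And>x m \<theta>. x \<in> simplices Y n \<Longrightarrow> \<theta> \<in> op_maps m n \<Longrightarrow> \<theta> ` {..m} \<noteq> {..n} \<Longrightarrow>
      act Y m n \<theta> x \<in> Z m"
    and g: "smap_on (sprod Y interval) (simplices (sprod Y interval)) B g"
    and f: "lifts_on (sprod Y interval) (cylinder Y Z e) E p g f"
    and Z': "\<And>m. Z' m \<subseteq> Z m \<union> {act Y m n \<theta> z | \<theta> z. \<theta> \<in> op_maps m n \<and> z \<in> simplices Y n}"
  obtains f' where "lifts_on (sprod Y interval) (cylinder Y Z' e) E p g f'"
    "\<And>m x. x \<in> cylinder Y Z e m \<Longrightarrow> f' m x = f m x"
proof -
  have "\<exists>f'. lifts_on (sprod Y interval) (cylinder_stage Y Z e n j) E p g f' \<and>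
      (\<forall>m. \<forall>x \<in> cylinder Y Z e m. f' m x = f m x)" if "j \<le> Suc n" for j
    using that
  proof (induction j)
    case 0
    have "cylinder_stage Y Z e n 0 m \<subseteq> cylinder Y Z e m" for m
      using act_in[OF Y] op_maps_le
      by (fastforce simp: cylinder_stage_def cylinder_def prism_stage_def split: if_splits)
    from lifts_on_subset[OF f this] show ?case by blast
  next
    case (Suc j)
    then obtain f1 where f1: "lifts_on (sprod Y interval) (cylinder_stage Y Z e n j) E p g f1"
      "\<forall>m. \<forall>x \<in> cylinder Y Z e m. f1 m x = f m x" by auto
    have "j \<le> n" using Suc.prems by simp
    from lift_cylinder_stage_Suc[OF Y E B p e this Z skel g f1(1)]
    obtain f' where "lifts_on (sprod Y interval) (cylinder_stage Y Z e n (Suc j)) E p g f'"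
      "\<And>m x. x \<in> cylinder_stage Y Z e n j m \<Longrightarrow> f' m x = f1 m x" by blast
    moreover have "cylinder Y Z e m \<subseteq> cylinder_stage Y Z e n j m" for m
      by (auto simp: cylinder_stage_def)
    ultimately show ?case using f1(2) by (metis subsetD)
  qed
  from this[OF order_refl] obtain f' where
    f': "lifts_on (sprod Y interval) (cylinder_stage Y Z e n (Suc n)) E p g f'"
    "\<And>m x. x \<in> cylinder Y Z e m \<Longrightarrow> f' m x = f m x" by blast
  have stage: "prism_stage e n (Suc n) m \<theta> t" if "\<theta> \<in> op_maps m n" for m \<theta> t
    using op_maps_le[OF that] by (auto simp: prism_stage_def less_Suc_eq_le)
  have "cylinder Y Z' e m \<subseteq> cylinder_stage Y Z e n (Suc n) m" for m
  proof
    fix x assume "x \<in> cylinder Y Z' e m"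
    then obtain y t where x: "x = (y, t)" "y \<in> simplices Y m" "t \<in> op_maps m 1"
        "(\<forall>i\<le>m. t i = e) \<or> y \<in> Z' m" by (auto simp: cylinder_def)
    then consider "x \<in> cylinder Y Z e m"
      | \<theta> z where "\<theta> \<in> op_maps m n" "z \<in> simplices Y n" "y = act Y m n \<theta> z"
      using Z'[of m] by (auto simp: cylinder_def)
    then show "x \<in> cylinder_stage Y Z e n (Suc n) m"
      by cases (use stage x in \<open>auto simp: cylinder_stage_def\<close>)
  qed
  from lifts_on_subset[OF f'(1) this] f'(2) that show thesis by blast
qed

text \<open>The relative skeleton of dimension \<open>n - 1\<close>: the strict bound
  \<open>k < n\<close> makes index 0 equal to \<open>X\<close>, the start of the induction.\<close>

definition skeleton :: "'y sset \<Rightarrow> (nat \<Rightarrow> 'y set) \<Rightarrow> nat \<Rightarrow> nat \<Rightarrow> 'y set" where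
  "skeleton Y X n m =
     X m \<union> {act Y m k \<theta> z | k \<theta> z. k < n \<and> \<theta> \<in> op_maps m k \<and> z \<in> simplices Y k}"

lemma subcomplex_skeleton:
  assumes Y: "simplicial_set Y" and X: "subcomplex Y X"
  shows "subcomplex Y (skeleton Y X n)"
  unfolding subcomplex_def
proof (intro conjI allI ballI impI)
  show "skeleton Y X n m \<subseteq> simplices Y m" for m
    using act_in[OF Y] subcomplex_in[OF X] by (auto simp: skeleton_def)
  fix k m \<phi> x assume x: "x \<in> skeleton Y X n m" and \<phi>: "\<phi> \<in> op_maps k m"
  show "act Y k m \<phi> x \<in> skeleton Y X n k"
  proof (cases "x \<in> X m")
    case True
    then show ?thesis using subcomplex_act[OF X True \<phi>] by (simp add: skeleton_def)
  next
    case False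
    then obtain l \<theta> z where "l < n" "\<theta> \<in> op_maps m l" "z \<in> simplices Y l" "x = act Y m l \<theta> z"
      using x by (auto simp: skeleton_def)
    then show ?thesis using act_comp[OF Y _ \<phi>] op_comp_in[OF \<phi>] unfolding skeleton_def by blast
  qed
qed

lemma skeleton_nonsurj:
  assumes Y: "simplicial_set Y" and x: "x \<in> simplices Y n" and \<theta>: "\<theta> \<in> op_maps m n"
    and ns: "\<theta> ` {..m} \<noteq> {..n}"
  shows "act Y m n \<theta> x \<in> skeleton Y X n m"
proof -
  obtain v where "v \<le> n" "v \<notin> \<theta> ` {..m}" using ns op_maps_le[OF \<theta>] by auto
  then obtain n' \<delta> \<psi> where *: "n' < n" "\<delta> \<in> op_maps n' n" "\<psi> \<in> op_maps m n'" "\<theta> = op_comp m \<delta> \<psi>"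
    by (rule op_nonsurj_factor[OF \<theta>])
  then have "act Y m n \<theta> x = act Y m n' \<psi> (act Y n' n \<delta> x)" by (simp add: act_comp[OF Y x])
  then show ?thesis using * act_in[OF Y x *(2)] by (auto simp: skeleton_def)
qed

text \<open>Lifts over successive skeleta are chosen compatibly and glued along the union. The
  choices extend one another, so every simplex has an eventually constant value.\<close>

lemma homotopy_extension_lifting:
  assumes Y: "simplicial_set Y" and E: "simplicial_set E" and B: "simplicial_set B"
    and p: "kan_fibration E B p" and e: "e \<le> 1" and X: "subcomplex Y X"
    and g: "smap_on (sprod Y interval) (simplices (sprod Y interval)) B g"
    and f: "lifts_on (sprod Y interval) (cylinder Y X e) E p g f"
  obtains f' where "lifts_on (sprod Y interval) (simplices (sprod Y interval)) E p g f'"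
    "\<And>m x. x \<in> cylinder Y X e m \<Longrightarrow> f' m x = f m x"
proof -
  let ?W = "sprod Y interval"
  let ?C = "\<lambda>n. cylinder Y (skeleton Y X n) e"
  have C_mono: "?C k m \<subseteq> ?C n m" if "k \<le> n" for k n m
    using that by (fastforce simp: cylinder_def skeleton_def)
  have C0: "?C 0 = cylinder Y X e" by (auto simp: cylinder_def skeleton_def)
  have "\<exists>F. \<forall>n. (lifts_on ?W (?C n) E p g (F n) \<and> (n = 0 \<longrightarrow> F n = f)) \<and>
      (\<forall>m. \<forall>x \<in> ?C n m. F (Suc n) m x = F n m x)"
  \<comment> \<open>Dependent choice leaves the initial member free; the clause for
    \<open>n = 0\<close> pins it to \<open>f\<close>.\<close>
  proof (rule dependent_nat_choice)
    show "\<exists>f0. lifts_on ?W (?C 0) E p g f0 \<and> ((0::nat) = 0 \<longrightarrow> f0 = f)" using f C0 by auto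
    fix f0 and n :: nat assume "lifts_on ?W (?C n) E p g f0 \<and> (n = 0 \<longrightarrow> f0 = f)"
    then have f0: "lifts_on ?W (?C n) E p g f0" ..
    have sk: "skeleton Y X (Suc n) m \<subseteq> skeleton Y X n m \<union>
        {act Y m n \<theta> z | \<theta> z. \<theta> \<in> op_maps m n \<and> z \<in> simplices Y n}" for m
      by (auto simp: skeleton_def less_Suc_eq)
    show "\<exists>f1. (lifts_on ?W (?C (Suc n)) E p g f1 \<and> (Suc n = 0 \<longrightarrow> f1 = f)) \<and>
        (\<forall>m. \<forall>x \<in> ?C n m. f1 m x = f0 m x)"
    proof (rule lift_cylinder_cells[OF Y E B p e subcomplex_skeleton[OF Y X]
          skeleton_nonsurj[OF Y] g f0 sk])
      fix f1 assume "lifts_on ?W (?C (Suc n)) E p g f1" "\<And>m x. x \<in> ?C n m \<Longrightarrow> f1 m x = f0 m x"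
      then show ?thesis by (intro exI[of _ f1]) simp
    qed
  qed
  then obtain F where "\<forall>n. (lifts_on ?W (?C n) E p g (F n) \<and> (n = 0 \<longrightarrow> F n = f)) \<and>
      (\<forall>m. \<forall>x \<in> ?C n m. F (Suc n) m x = F n m x)" ..
  then have F: "\<And>n. lifts_on ?W (?C n) E p g (F n)" and F0: "F 0 = f"
    and F_Suc: "\<And>n m x. x \<in> ?C n m \<Longrightarrow> F (Suc n) m x = F n m x" by auto
  have F_le: "F n m x = F k m x" if "k \<le> n" "x \<in> ?C k m" for k n m x
    using that(1)
  proof (induction n rule: dec_induct)
    case (step n)
    then show ?case using F_Suc[of x n m] C_mono[of k n m] that(2) by auto
  qed simp
  have top: "x \<in> ?C n m" if "x \<in> simplices ?W m" "m < n" for n m x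
  proof -
    have "y \<in> skeleton Y X n m" if "y \<in> simplices Y m" for y
      using act_id[OF Y that, symmetric] that \<open>m < n\<close> op_id_in[of m] unfolding skeleton_def by blast
    then show ?thesis using that(1) by (auto simp: cylinder_def)
  qed
  \<comment> \<open>Every \<open>m\<close>-simplex lies in the skeleton of index
    \<open>Suc m\<close>, so its value no longer changes from there on.\<close>
  define f' where "f' m = F (Suc m) m" for m
  have f'_eq: "f' m x = F n m x" if "x \<in> simplices ?W m" "m < n" for n m x
    using F_le[OF _ top[OF that(1), of "Suc m"], of n] that by (simp add: f'_def)
  have W: "simplicial_set ?W" by (intro simplicial_set_sprod Y simplicial_set_interval)
  have "lifts_on ?W (simplices ?W) E p g f'"
    unfolding lifts_on_def
  proof (intro conjI allI ballI smap_onI)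
    fix m x assume x: "x \<in> simplices ?W m"
    note Fx = F[of "Suc m", unfolded lifts_on_def] and xC = top[OF x, of "Suc m", simplified]
    show "f' m x \<in> simplices E m" "p m (f' m x) = g m x"
      using Fx xC by (auto simp: f'_def smap_on_def)
    fix k \<theta> assume \<theta>: "\<theta> \<in> op_maps k m"
    \<comment> \<open>A common index beyond both dimensions, since \<open>\<theta>\<close> may raise
      the dimension.\<close>
    let ?n = "Suc (k + m)"
    have "F ?n k (act ?W k m \<theta> x) = act E k m \<theta> (F ?n m x)"
      using F[of ?n] top[OF x, of ?n] \<theta> by (auto simp: lifts_on_def smap_on_def)
    then show "f' k (act ?W k m \<theta> x) = act E k m \<theta> (f' m x)"
      using f'_eq[OF x, of ?n] f'_eq[OF act_in[OF W x \<theta>], of ?n] by simp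
  qed
  moreover have "f' m x = f m x" if "x \<in> cylinder Y X e m" for m x
    using F_le[of 0 "Suc m" x m] that C0 F0 by (simp add: f'_def)
  ultimately show thesis using that by blast
qed


section \<open>Contracting the fibered path space onto constant paths\<close>

abbreviation const_op :: "nat \<Rightarrow> nat \<Rightarrow> nat \<Rightarrow> nat" where
  "const_op c n \<equiv> restrict (\<lambda>_. c) {..n}"

lemma const_op_in: "c \<le> n \<Longrightarrow> const_op c m \<in> op_maps m n"
  by (rule restrict_in_op_maps) auto

lemma const_op_comp: "\<phi> \<in> op_maps k m \<Longrightarrow> op_comp k (const_op c m) \<phi> = const_op c k"
  by (auto simp: op_comp_def compose_def op_maps_def intro!: restrict_ext)

lemma std_simplex_simps [simp]:
  "simplices (std_simplex n) m = op_maps m n"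
  "act (std_simplex n) k m \<phi> \<theta> = op_comp k \<theta> \<phi>"
  by (simp_all add: std_simplex_def)

lemma path_eqI:
  assumes "\<alpha> \<in> smaps (sprod (std_simplex n) interval) A" "\<beta> \<in> smaps (sprod (std_simplex n) interval) A"
    and "\<And>m \<theta> s. \<theta> \<in> op_maps m n \<Longrightarrow> s \<in> op_maps m 1 \<Longrightarrow> \<alpha> m (\<theta>, s) = \<beta> m (\<theta>, s)"
  shows "\<alpha> = \<beta>"
proof
  fix m
  show "\<alpha> m = \<beta> m"
    by (rule extensionalityI[of _ "op_maps m n \<times> op_maps m 1"])
      (use assms in \<open>auto simp: smaps_def PiE_iff\<close>)
qed

lemma const_map_interval_apply:
  assumes "a \<in> simplices A n" "\<theta> \<in> op_maps m n" "s \<in> op_maps m 1"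
  shows "const_map interval A n a m (\<theta>, s) = act A m n \<theta> a"
  using assms by (simp add: const_map_def)

lemma op_times_id_apply:
  assumes "\<theta> \<in> op_maps j m" "s \<in> op_maps j 1"
  shows "smap_comp (sprod (std_simplex m) interval) \<alpha> (op_times_id m \<phi> interval) j (\<theta>, s) =
    \<alpha> j (op_comp j \<phi> \<theta>, s)"
  using assms by (simp add: smap_comp_def op_times_id_def compose_def)

text \<open>Evaluation at time 0, read off at the universal simplex \<open>op_id n\<close>.\<close>

definition path_start :: "nat \<Rightarrow> 'g \<times> 'a path \<Rightarrow> 'a" where
  "path_start n x = snd x n (op_id n, const_op 0 n)"

text \<open>The pointwise \<open>min\<close> is the connection Delta^1 x Delta^1 -> Delta^1. The
  time \<open>t\<close> lives over the base simplex and is pulled back along \<open>\<theta>\<close>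
  before it is compared with the path parameter \<open>s\<close>.\<close>

definition path_contract :: "nat \<Rightarrow> ('g \<times> 'a path) \<times> (nat \<Rightarrow> nat) \<Rightarrow> 'g \<times> 'a path" where
  "path_contract n = (\<lambda>((\<gamma>, \<alpha>), t). (\<gamma>, \<lambda>m. restrict
     (\<lambda>(\<theta>, s). \<alpha> m (\<theta>, restrict (\<lambda>i. min (t (\<theta> i)) (s i)) {..m})) (op_maps m n \<times> op_maps m 1)))"

lemma min_op_in:
  assumes "\<theta> \<in> op_maps m n" "s \<in> op_maps m 1" "t \<in> op_maps n 1"
  shows "restrict (\<lambda>i. min (t (\<theta> i)) (s i)) {..m} \<in> op_maps m 1"
proof (rule restrict_in_op_maps)
  fix i j assume "i \<le> j" "j \<le> m"
  then show "min (t (\<theta> i)) (s i) \<le> min (t (\<theta> j)) (s j)"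
    using op_maps_mono[OF assms(1)] op_maps_mono[OF assms(2)] op_maps_mono[OF assms(3)]
      op_maps_le[OF assms(1)] by (intro min.mono) auto
qed (use op_maps_le[OF assms(2)] in \<open>simp add: min.coboundedI2\<close>)

context
  fixes \<Gamma> :: "'g sset" and A :: "'a sset" and p :: "nat \<Rightarrow> 'a \<Rightarrow> 'g"
  assumes \<Gamma>: "simplicial_set \<Gamma>" and A: "simplicial_set A" and p: "p \<in> smaps A \<Gamma>"
begin

abbreviation (input) "PS \<equiv> path_space \<Gamma> A p"

text \<open>The pullback condition says that the path is vertical: its image under \<open>p\<close>
  depends on \<open>\<theta>\<close> only and not on \<open>s\<close>. Hence reparametrizing
  \<open>s\<close> stays in the fibered path space.\<close>

lemma path_space_iff:
  "(\<gamma>, \<alpha>) \<in> simplices PS n \<longleftrightarrow> \<gamma> \<in> simplices \<Gamma> n \<and>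
     \<alpha> \<in> smaps (sprod (std_simplex n) interval) A \<and>
     (\<forall>m. \<forall>\<theta>\<in>op_maps m n. \<forall>s\<in>op_maps m 1. p m (\<alpha> m (\<theta>, s)) = act \<Gamma> m n \<theta> \<gamma>)"
proof -
  have "const_map interval \<Gamma> n \<gamma> = smap_comp (sprod (std_simplex n) interval) p \<alpha> \<longleftrightarrow>
      (\<forall>m. \<forall>\<theta>\<in>op_maps m n. \<forall>s\<in>op_maps m 1. p m (\<alpha> m (\<theta>, s)) = act \<Gamma> m n \<theta> \<gamma>)"
    (is "?l = ?r \<longleftrightarrow> ?R") if \<gamma>: "\<gamma> \<in> simplices \<Gamma> n" and \<alpha>: "\<alpha> \<in> smaps (sprod (std_simplex n) interval) A"
  proof -
    have S: "simplicial_set (sprod (std_simplex n) interval)"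
      by (intro simplicial_set_sprod simplicial_set_std_simplex simplicial_set_interval)
    have l: "?l \<in> smaps (sprod (std_simplex n) interval) \<Gamma>"
      using smaps_in[OF const_map_in[OF simplicial_set_interval \<Gamma>] \<gamma>] by (simp add: ihom_def)
    have r: "?r \<in> smaps (sprod (std_simplex n) interval) \<Gamma>" by (rule smap_comp_in[OF S \<alpha> p])
    have r_app: "?r m (\<theta>, s) = p m (\<alpha> m (\<theta>, s))" if "\<theta> \<in> op_maps m n" "s \<in> op_maps m 1" for m \<theta> s
      using that by (simp add: smap_comp_def compose_def)
    show ?thesis
    proof
      assume "?l = ?r"
      then show ?R using r_app const_map_interval_apply[OF \<gamma>] by metis
    next
      assume R: ?R
      show "?l = ?r" by (rule path_eqI[OF l r]) (use R r_app const_map_interval_apply[OF \<gamma>] in simp)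
    qed
  qed
  then show ?thesis by (auto simp: path_space_def pullback_def ihom_def ihom_map_def)
qed

lemma act_path_space:
  "act PS m n \<phi> (\<gamma>, \<alpha>) =
     (act \<Gamma> m n \<phi> \<gamma>, smap_comp (sprod (std_simplex m) interval) \<alpha> (op_times_id m \<phi> interval))"
  by (simp add: path_space_def pullback_def ihom_def)

lemma simplicial_set_PS: "simplicial_set PS"
  by (rule simplicial_set_path_space[OF \<Gamma> p])

lemma path_start_smap: "smap_on PS (simplices PS) A path_start"
proof (rule smap_onI)
  fix n x assume x: "x \<in> simplices PS n"
  obtain \<gamma> \<alpha> where x_eq: "x = (\<gamma>, \<alpha>)" by (cases x)
  have \<alpha>: "\<alpha> \<in> smaps (sprod (std_simplex n) interval) A" using x by (simp add: x_eq path_space_iff)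
  have i0: "(op_id n, const_op 0 n) \<in> simplices (sprod (std_simplex n) interval) n"
    by (simp add: const_op_in)
  show "path_start n x \<in> simplices A n" using smaps_in[OF \<alpha> i0] by (simp add: path_start_def x_eq)
  fix m \<phi> assume \<phi>: "\<phi> \<in> op_maps m n"
  show "path_start m (act PS m n \<phi> x) = act A m n \<phi> (path_start n x)"
    using smaps_act[OF \<alpha> i0 \<phi>]
    by (simp add: path_start_def x_eq act_path_space op_times_id_apply const_op_in
        op_comp_id_left[OF \<phi>] op_comp_id_right[OF \<phi>] const_op_comp[OF \<phi>])
qed

lemma path_start_refl: "a \<in> simplices A n \<Longrightarrow> path_start n (path_refl A p n a) = a"
  by (simp add: path_start_def path_refl_def const_map_interval_apply const_op_in act_id[OF A])

lemma path_contract_in: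
  assumes x: "x \<in> simplices PS n" and t: "t \<in> op_maps n 1"
  shows "path_contract n (x, t) \<in> simplices PS n"
proof -
  obtain \<gamma> \<alpha> where x_eq: "x = (\<gamma>, \<alpha>)" by (cases x)
  have \<alpha>: "\<alpha> \<in> smaps (sprod (std_simplex n) interval) A" and \<gamma>: "\<gamma> \<in> simplices \<Gamma> n"
    and p\<alpha>: "\<And>m \<theta> s. \<theta> \<in> op_maps m n \<Longrightarrow> s \<in> op_maps m 1 \<Longrightarrow> p m (\<alpha> m (\<theta>, s)) = act \<Gamma> m n \<theta> \<gamma>"
    using x by (simp_all add: x_eq path_space_iff)
  let ?u = "\<lambda>m \<theta> s. restrict (\<lambda>i. min (t (\<theta> i)) (s i)) {..m}"
  let ?\<beta> = "\<lambda>m. \<lambda>(\<theta>, s). \<alpha> m (\<theta>, ?u m \<theta> s)"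
  have "smap_on (sprod (std_simplex n) interval) (simplices (sprod (std_simplex n) interval)) A ?\<beta>"
  proof (rule smap_onI)
    fix m y assume y: "y \<in> simplices (sprod (std_simplex n) interval) m"
    obtain \<theta> s where y_eq: "y = (\<theta>, s)" by (cases y)
    have \<theta>: "\<theta> \<in> op_maps m n" and s: "s \<in> op_maps m 1" using y by (auto simp: y_eq)
    have u: "(\<theta>, ?u m \<theta> s) \<in> simplices (sprod (std_simplex n) interval) m"
      using \<theta> min_op_in[OF \<theta> s t] by simp
    show "?\<beta> m y \<in> simplices A m" using smaps_in[OF \<alpha> u] by (simp add: y_eq)
    fix k \<psi> assume \<psi>: "\<psi> \<in> op_maps k m"
    have "?u k (op_comp k \<theta> \<psi>) (op_comp k s \<psi>) = op_comp k (?u m \<theta> s) \<psi>"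
      by (rule op_maps_eqI[OF min_op_in[OF op_comp_in[OF \<psi> \<theta>] op_comp_in[OF \<psi> s] t]
            op_comp_in[OF \<psi> min_op_in[OF \<theta> s t]]])
        (simp add: op_maps_le[OF \<psi>])
    then show "?\<beta> k (act (sprod (std_simplex n) interval) k m \<psi> y) = act A k m \<psi> (?\<beta> m y)"
      using smaps_act[OF \<alpha> u \<psi>] by (simp add: y_eq)
  qed
  from restrict_in_smaps[OF this]
  have "(\<lambda>m. restrict (?\<beta> m) (op_maps m n \<times> op_maps m 1)) \<in> smaps (sprod (std_simplex n) interval) A"
    by (simp add: simplicial_set_sprod simplicial_set_std_simplex simplicial_set_interval)
  then show ?thesis using \<gamma> p\<alpha> min_op_in[OF _ _ t] by (simp add: x_eq path_contract_def path_space_iff)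
qed

lemma path_contract_smap:
  "smap_on (sprod PS interval) (simplices (sprod PS interval)) PS path_contract"
proof (rule smap_onI)
  fix n xt assume xt: "xt \<in> simplices (sprod PS interval) n"
  obtain \<gamma> \<alpha> t where xt_eq: "xt = ((\<gamma>, \<alpha>), t)" by (metis prod.collapse)
  have x: "(\<gamma>, \<alpha>) \<in> simplices PS n" and t: "t \<in> op_maps n 1" using xt by (auto simp: xt_eq)
  show c_in: "path_contract n xt \<in> simplices PS n" using path_contract_in[OF x t] by (simp add: xt_eq)
  fix k \<phi> assume \<phi>: "\<phi> \<in> op_maps k n"
  have l_in: "path_contract k (act PS k n \<phi> (\<gamma>, \<alpha>), op_comp k t \<phi>) \<in> simplices PS k"
    by (rule path_contract_in[OF act_in[OF simplicial_set_PS x \<phi>] op_comp_in[OF \<phi> t]])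
  have r_in: "act PS k n \<phi> (path_contract n xt) \<in> simplices PS k"
    by (rule act_in[OF simplicial_set_PS c_in \<phi>])
  have "snd (path_contract k (act PS k n \<phi> (\<gamma>, \<alpha>), op_comp k t \<phi>)) =
      snd (act PS k n \<phi> (path_contract n xt))"
  proof (rule path_eqI[where A = A])
    fix m \<theta> s assume \<theta>: "\<theta> \<in> op_maps m k" and s: "s \<in> op_maps m 1"
    have "restrict (\<lambda>i. min (op_comp k t \<phi> (\<theta> i)) (s i)) {..m} =
        restrict (\<lambda>i. min (t (op_comp m \<phi> \<theta> i)) (s i)) {..m}"
      by (rule restrict_ext) (simp add: op_maps_le[OF \<theta>])
    moreover note min_op_in[OF \<theta> s op_comp_in[OF \<phi> t]]
    ultimately show "snd (path_contract k (act PS k n \<phi> (\<gamma>, \<alpha>), op_comp k t \<phi>)) m (\<theta>, s) =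
        snd (act PS k n \<phi> (path_contract n xt)) m (\<theta>, s)"
      using \<theta> s op_comp_in[OF \<theta> \<phi>]
      by (simp add: xt_eq act_path_space path_contract_def op_times_id_apply)
  qed (use l_in r_in in \<open>simp_all add: path_space_iff[of "fst x" "snd x" for x, simplified]\<close>)
  then show "path_contract k (act (sprod PS interval) k n \<phi> xt) = act PS k n \<phi> (path_contract n xt)"
    by (simp add: xt_eq prod_eq_iff) (simp add: act_path_space path_contract_def)
qed

lemma path_contract_1:
  assumes x: "x \<in> simplices PS n" and t: "\<forall>i\<le>n. t i = 1"
  shows "path_contract n (x, t) = x"
proof -
  obtain \<gamma> \<alpha> where x_eq: "x = (\<gamma>, \<alpha>)" by (cases x)
  have \<alpha>: "\<alpha> \<in> smaps (sprod (std_simplex n) interval) A" using x by (simp add: x_eq path_space_iff)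
  have "restrict (\<lambda>i. min (t (\<theta> i)) (s i)) {..m} = s" if "\<theta> \<in> op_maps m n" "s \<in> op_maps m 1" for m \<theta> s
    by (rule extensionalityI[of _ "{..m}"])
      (use t op_maps_le[OF that(1)] op_maps_le[OF that(2)] that in \<open>auto simp: op_maps_def PiE_iff\<close>)
  then have "restrict (\<lambda>(\<theta>, s). \<alpha> m (\<theta>, restrict (\<lambda>i. min (t (\<theta> i)) (s i)) {..m}))
      (op_maps m n \<times> op_maps m 1) = \<alpha> m" for m
    by (intro extensionalityI[of _ "op_maps m n \<times> op_maps m 1"])
      (use \<alpha> in \<open>auto simp: smaps_def PiE_iff\<close>)
  then show ?thesis by (simp add: x_eq path_contract_def)
qed

text \<open>At time 0 every parameter becomes 0, and naturality of \<open>\<alpha>\<close>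
  identifies its values there with restrictions of the start point.\<close>

lemma path_contract_0:
  assumes x: "x \<in> simplices PS n" and t: "\<forall>i\<le>n. t i = 0"
  shows "path_contract n (x, t) = path_refl A p n (path_start n x)"
proof -
  obtain \<gamma> \<alpha> where x_eq: "x = (\<gamma>, \<alpha>)" by (cases x)
  have \<alpha>: "\<alpha> \<in> smaps (sprod (std_simplex n) interval) A" and \<gamma>: "\<gamma> \<in> simplices \<Gamma> n"
    and p\<alpha>: "\<And>m \<theta> s. \<theta> \<in> op_maps m n \<Longrightarrow> s \<in> op_maps m 1 \<Longrightarrow> p m (\<alpha> m (\<theta>, s)) = act \<Gamma> m n \<theta> \<gamma>"
    using x by (simp_all add: x_eq path_space_iff)
  have a: "path_start n x \<in> simplices A n" by (rule smap_on_in[OF path_start_smap x])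
  have i0: "(op_id n, const_op 0 n) \<in> simplices (sprod (std_simplex n) interval) n"
    by (simp add: const_op_in)
  have "\<alpha> m (\<theta>, restrict (\<lambda>i. min (t (\<theta> i)) (s i)) {..m}) = act A m n \<theta> (path_start n x)"
    if \<theta>: "\<theta> \<in> op_maps m n" for m \<theta> s
  proof -
    have "restrict (\<lambda>i. min (t (\<theta> i)) (s i)) {..m} = const_op 0 m"
      by (rule restrict_ext) (simp add: t op_maps_le[OF \<theta>])
    then show ?thesis using smaps_act[OF \<alpha> i0 \<theta>]
      by (simp add: x_eq path_start_def op_comp_id_left[OF \<theta>] const_op_comp[OF \<theta>])
  qed
  then have "(\<lambda>m. restrict (\<lambda>(\<theta>, s). \<alpha> m (\<theta>, restrict (\<lambda>i. min (t (\<theta> i)) (s i)) {..m}))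
      (op_maps m n \<times> op_maps m 1)) = const_map interval A n (path_start n x)"
    using a by (auto simp: const_map_def intro!: ext)
  moreover have "p n (path_start n x) = \<gamma>"
    using p\<alpha>[of "op_id n" n "const_op 0 n"] act_id[OF \<Gamma> \<gamma>] by (simp add: x_eq path_start_def const_op_in)
  ultimately show ?thesis using a by (simp add: x_eq path_contract_def path_refl_def)
qed

lemma path_contract_refl:
  assumes a: "a \<in> simplices A n" and t: "t \<in> op_maps n 1"
  shows "path_contract n (path_refl A p n a, t) = path_refl A p n a"
proof -
  have "(\<lambda>m. restrict (\<lambda>(\<theta>, s). const_map interval A n a m (\<theta>, restrict (\<lambda>i. min (t (\<theta> i)) (s i)) {..m}))
      (op_maps m n \<times> op_maps m 1)) = const_map interval A n a" (is "?l = ?r")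
  proof
    fix m
    show "?l m = ?r m"
      by (rule extensionalityI[of _ "op_maps m n \<times> op_maps m 1"])
        (use a min_op_in[OF _ _ t] in \<open>auto simp: const_map_interval_apply, auto simp: const_map_def\<close>)
  qed
  then show ?thesis using a by (simp add: path_refl_def path_contract_def)
qed

end


section \<open>Extending the partial section\<close>

theorem proposition3p10:
  fixes \<Gamma> :: "'g sset" and A :: "'a sset" and P :: "'p sset" and Q :: "'q sset"
    and p :: "nat \<Rightarrow> 'a \<Rightarrow> 'g"
    and \<rho> :: "nat \<Rightarrow> 'p \<Rightarrow> 'g \<times> 'a path"
    and \<chi> :: "nat \<Rightarrow> 'q \<Rightarrow> 'p"
    and d :: "nat \<Rightarrow> 'a \<times> 'p \<Rightarrow> 'q"
  assumes "simplicial_set \<Gamma>" and "simplicial_set A"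
    and "simplicial_set P" and "simplicial_set Q"
    and "kan_fibration A \<Gamma> p"
    and "kan_fibration P (path_space \<Gamma> A p) \<rho>"
    and "kan_fibration Q P \<chi>"
    and "d \<in> smaps (pullback A P (path_refl A p) \<rho>) Q"
    and "smap_comp (pullback A P (path_refl A p) \<rho>) \<chi> d
           = pullback_snd A P (path_refl A p) \<rho>"
  shows "\<exists>s \<in> smaps P Q. smap_comp P \<chi> s = smap_id P \<and>
           smap_comp (pullback A P (path_refl A p) \<rho>) s (pullback_snd A P (path_refl A p) \<rho>) = d"
proof -
  note \<Gamma> = assms(1) and A = assms(2) and P = assms(3) and Q = assms(4) and \<rho>_kan = assms(6)
    and \<chi>_kan = assms(7) and d = assms(8) and \<chi>d = assms(9)
  have p: "p \<in> smaps A \<Gamma>" and \<rho>: "\<rho> \<in> smaps P (path_space \<Gamma> A p)"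
    using assms(5,6) by (auto simp: kan_fibration_def)
  let ?PS = "path_space \<Gamma> A p" and ?R = "pullback A P (path_refl A p) \<rho>"
  let ?W = "sprod P interval"
  note PS = simplicial_set_path_space[OF \<Gamma> p]
  note refl = path_refl_in[OF \<Gamma> A p]
  note start = path_start_smap[OF \<Gamma> A p]

  define X where "X m = {x \<in> simplices P m. \<exists>a \<in> simplices A m. \<rho> m x = path_refl A p m a}" for m
  have X: "subcomplex P X"
    unfolding subcomplex_def
  proof (intro conjI allI ballI impI)
    show "X m \<subseteq> simplices P m" for m by (auto simp: X_def)
    fix k m \<theta> x assume "x \<in> X m" and \<theta>: "\<theta> \<in> op_maps k m"
    then obtain a where x: "x \<in> simplices P m" and a: "a \<in> simplices A m" "\<rho> m x = path_refl A p m a"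
      by (auto simp: X_def)
    have "\<rho> k (act P k m \<theta> x) = path_refl A p k (act A k m \<theta> a)"
      using smaps_act[OF \<rho> x \<theta>] smaps_act[OF refl a(1) \<theta>] a(2) by simp
    then show "act P k m \<theta> x \<in> X k" using act_in[OF P x \<theta>] act_in[OF A a(1) \<theta>] by (auto simp: X_def)
  qed
  note cyl = subcomplex_cylinder[OF P X]
  have fst_smap: "smap_on ?W (simplices ?W) P (\<lambda>m. fst)"
    by (rule smap_onI) auto

  define h where "h m = (\<lambda>(x, t). path_contract m (\<rho> m x, t))" for m
  have h: "smap_on ?W (simplices ?W) ?PS h"
  proof (rule smap_onI)
    fix m xt assume xt: "xt \<in> simplices ?W m"
    obtain x t where xt_eq: "xt = (x, t)" by (cases xt)
    have x: "x \<in> simplices P m" and t: "t \<in> op_maps m 1" using xt by (auto simp: xt_eq)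
    have \<rho>x: "(\<rho> m x, t) \<in> simplices (sprod ?PS interval) m" using smaps_in[OF \<rho> x] t by simp
    note c = path_contract_smap[OF \<Gamma> A p]
    show "h m xt \<in> simplices ?PS m" using smap_on_in[OF c \<rho>x] by (simp add: h_def xt_eq)
    fix k \<theta> assume \<theta>: "\<theta> \<in> op_maps k m"
    show "h k (act ?W k m \<theta> xt) = act ?PS k m \<theta> (h m xt)"
      using smap_on_act[OF c \<rho>x \<theta>] smaps_act[OF \<rho> x \<theta>] by (simp add: h_def xt_eq)
  qed
  \<comment> \<open>The projection lifts \<open>h\<close> on the cylinder: the contraction is the
    identity at time 1 and fixes constant paths at all times.\<close>
  have "lifts_on ?W (cylinder P X 1) P \<rho> h (\<lambda>m. fst)"
    unfolding lifts_on_def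
  proof (intro conjI allI ballI)
    show "smap_on ?W (cylinder P X 1) P (\<lambda>m. fst)"
      using fst_smap by (rule smap_on_subset) (auto simp: cylinder_def)
    fix m xt assume "xt \<in> cylinder P X 1 m"
    then show "\<rho> m (fst xt) = h m xt"
      using path_contract_1[OF \<Gamma> A p smaps_in[OF \<rho>]] path_contract_refl[OF \<Gamma> A p]
      by (auto simp: cylinder_def X_def h_def)
  qed
  then obtain K where K: "lifts_on ?W (simplices ?W) P \<rho> h K"
    and K_eq: "\<And>m xt. xt \<in> cylinder P X 1 m \<Longrightarrow> K m xt = fst xt"
    using homotopy_extension_lifting[OF P P PS \<rho>_kan order_refl X h] by metis
  have K_smap: "smap_on ?W (simplices ?W) P K" using K by (simp add: lifts_on_def)
  have K_X: "K m xt \<in> X m" if xt: "xt \<in> cylinder P X 0 m" for m xt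
  proof -
    obtain x t where xt_eq: "xt = (x, t)" by (cases xt)
    have x: "x \<in> simplices P m" and t: "t \<in> op_maps m 1" using xt by (auto simp: xt_eq cylinder_def)
    show ?thesis
    proof (cases "x \<in> X m")
      case True
      then have "xt \<in> cylinder P X 1 m" using x t by (simp add: xt_eq cylinder_def)
      then show ?thesis using K_eq True by (simp add: xt_eq)
    next
      case False
      then have t0: "\<forall>i\<le>m. t i = 0" using xt by (simp add: xt_eq cylinder_def)
      have W_xt: "xt \<in> simplices ?W m" using x t by (simp add: xt_eq)
      have "\<rho> m (K m xt) = path_refl A p m (path_start m (\<rho> m x))"
        using K W_xt path_contract_0[OF \<Gamma> A p smaps_in[OF \<rho> x] t0]
        by (simp add: lifts_on_def h_def xt_eq)
      then show ?thesis
        using smap_on_in[OF K_smap W_xt] smap_on_in[OF start smaps_in[OF \<rho> x]] by (auto simp: X_def)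
    qed
  qed

  \<comment> \<open>\<open>path_start\<close> recovers the point from its constant path, so the
    pullback maps isomorphically onto \<open>X\<close>, and \<open>d'\<close> is \<open>d\<close>
    transported along this isomorphism.\<close>
  define d' where "d' m x = d m (path_start m (\<rho> m x), x)" for m x
  have X_R: "(path_start m (\<rho> m x), x) \<in> simplices ?R m" if "x \<in> X m" for m x
    using that path_start_refl[OF \<Gamma> A p] by (auto simp: X_def pullback_def)
  have d'_smap: "smap_on P X Q d'"
  proof (rule smap_onI)
    fix m x assume x: "x \<in> X m"
    have xP: "x \<in> simplices P m" by (rule subcomplex_in[OF X x])
    show "d' m x \<in> simplices Q m" using smaps_in[OF d X_R[OF x]] by (simp add: d'_def)
    fix k \<theta> assume \<theta>: "\<theta> \<in> op_maps k m"
    show "d' k (act P k m \<theta> x) = act Q k m \<theta> (d' m x)"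
      using smaps_act[OF d X_R[OF x] \<theta>] smaps_act[OF \<rho> xP \<theta>]
        smap_on_act[OF start smaps_in[OF \<rho> xP] \<theta>]
      by (simp add: d'_def pullback_def)
  qed
  have \<chi>d': "\<chi> m (d' m x) = x" if x: "x \<in> X m" for m x
    using fun_cong[OF fun_cong[OF \<chi>d, of m], of "(path_start m (\<rho> m x), x)"] X_R[OF x]
    by (simp add: smap_comp_def compose_def pullback_snd_def d'_def)
  have d'K: "lifts_on ?W (cylinder P X 0) Q \<chi> K (\<lambda>m xt. d' m (K m xt))"
    unfolding lifts_on_def
  proof (intro conjI allI ballI smap_onI)
    fix m xt assume xt: "xt \<in> cylinder P X 0 m"
    show "d' m (K m xt) \<in> simplices Q m" by (rule smap_on_in[OF d'_smap K_X[OF xt]])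
    show "\<chi> m (d' m (K m xt)) = K m xt" by (rule \<chi>d'[OF K_X[OF xt]])
    fix k \<theta> assume \<theta>: "\<theta> \<in> op_maps k m"
    show "d' k (K k (act ?W k m \<theta> xt)) = act Q k m \<theta> (d' m (K m xt))"
      using smap_on_act[OF K_smap subcomplex_in[OF cyl xt] \<theta>] smap_on_act[OF d'_smap K_X[OF xt] \<theta>]
      by simp
  qed
  \<comment> \<open>The base of this second lifting problem is \<open>K\<close> itself, so at time
    1, where \<open>K\<close> is the projection, \<open>f\<close> is a section of
    \<open>\<chi>\<close>.\<close>
  obtain f where f: "lifts_on ?W (simplices ?W) Q \<chi> K f"
    and f_eq: "\<And>m xt. xt \<in> cylinder P X 0 m \<Longrightarrow> f m xt = d' m (K m xt)"
    using homotopy_extension_lifting[OF P Q P \<chi>_kan le0 X K_smap d'K] by blast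
  have f_smap: "smap_on ?W (simplices ?W) Q f" using f by (simp add: lifts_on_def)

  define s where "s m = restrict (\<lambda>x. f m (x, const_op 1 m)) (simplices P m)" for m
  have end_W: "(x, const_op 1 m) \<in> simplices ?W m" if "x \<in> simplices P m" for m x
    using that by (simp add: const_op_in)
  have "smap_on P (simplices P) Q (\<lambda>m x. f m (x, const_op 1 m))"
  proof (rule smap_onI)
    fix m x assume x: "x \<in> simplices P m"
    show "f m (x, const_op 1 m) \<in> simplices Q m" by (rule smap_on_in[OF f_smap end_W[OF x]])
    fix k \<theta> assume \<theta>: "\<theta> \<in> op_maps k m"
    show "f k (act P k m \<theta> x, const_op 1 k) = act Q k m \<theta> (f m (x, const_op 1 m))"
      using smap_on_act[OF f_smap end_W[OF x] \<theta>] by (simp only: sprod_interval const_op_comp[OF \<theta>])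
  qed
  then have s: "s \<in> smaps P Q"
    unfolding s_def by (rule restrict_in_smaps[OF _ P])
  have K_end: "K m (x, const_op 1 m) = x" if x: "x \<in> simplices P m" for m x
    using K_eq[of "(x, const_op 1 m)" m] x by (simp add: cylinder_def const_op_in)
  have "\<chi> m (s m x) = x" if x: "x \<in> simplices P m" for m x
    using f end_W[OF x] K_end[OF x] x by (simp only: lifts_on_def s_def restrict_apply' simp_thms)
  then have "smap_comp P \<chi> s = smap_id P"
    by (auto simp: smap_comp_def compose_def smap_id_def intro!: ext)
  moreover have "smap_comp ?R s (pullback_snd A P (path_refl A p) \<rho>) = d"
  proof
    fix m
    show "smap_comp ?R s (pullback_snd A P (path_refl A p) \<rho>) m = d m"
    proof (rule extensionalityI[of _ "simplices ?R m"])
      show "d m \<in> extensional (simplices ?R m)" using d by (auto simp: smaps_def PiE_iff)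
      fix ax assume ax: "ax \<in> simplices ?R m"
      obtain a x where ax_eq: "ax = (a, x)" by (cases ax)
      have a: "a \<in> simplices A m" and x: "x \<in> simplices P m" and ax': "\<rho> m x = path_refl A p m a"
        using ax by (auto simp: ax_eq pullback_def)
      have xX: "x \<in> X m" using a x ax' by (auto simp: X_def)
      \<comment> \<open>Over \<open>X\<close> the cylinder for \<open>e = 0\<close> contains all
        times, so \<open>f\<close> is prescribed at time 1 too, and there \<open>K\<close> returns
        \<open>x\<close>.\<close>
      have "s m x = d' m x"
        using f_eq[of "(x, const_op 1 m)" m] K_end[OF x] x xX by (simp add: s_def cylinder_def const_op_in)
      also have "\<dots> = d m (a, x)"
        using path_start_refl[OF \<Gamma> A p a] ax' by (simp add: d'_def)
      finally show "smap_comp ?R s (pullback_snd A P (path_refl A p) \<rho>) m ax = d m ax"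
        using ax by (simp add: smap_comp_def compose_def pullback_snd_def ax_eq)
    qed (simp add: smap_comp_def compose_def)
  qed
  ultimately show ?thesis using s by blast
qed

end
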